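(* The matrix-valued function $H_a$ is the unique bounded Borel function $(0,\infty)\to\mathbb R^{m\times m}$ satisfying $H_a=\mathcal T_aH_a$. Moreover, $0<H_a(v)\mathbf 1<\mathbf 1$ componentwise for every $v>0$, where $\mathbf 1$ is the column vector of ones. If $H_a^{(0)}=0$ and $H_a^{(n+1)}=\mathcal T_aH_a^{(n)}$ for $n\ge0$, then $$\|H_a-H_a^{(n)}\|_\infty\le\beta^n .$$
   Context: Model. Let $E=\{1,\dots,m\}$; for each $i\in E$ let $c_i>0$, $\lambda_i>0$, $p_i\in(0,1)$, and let $Q=(q_{ij})_{i,j\in E}$ be a stochastic matrix. $(X,J)$ is the Markov process on $[0,\infty)\times E$ with the following dynamics: while the phase $J$ equals $i$, the level $X$ increases linearly with slope $1/c_i$ and the next jump occurs at rate $\lambda_i$; at a jump from $(x,i)$ the process moves to $(p_i x,j)$ with probability $q_{ij}$ ($j=i$ is allowed). Fix $w>0$ and $a>0$; put $z_i=c_i(\lambda_i+w)$ and $\beta=\max_{i\in E}\frac{\lambda_i}{w+\lambda_i}(1-e^{-z_ia})<1$. For a matrix $M$, $|M|=\max_i\sum_j|M_{ij}|$, and $\|G\|_\infty=\sup_{v>0}|G(v)|$ for $G:(0,\infty)\to\mathbb R^{m\times m}$. Given an initial running minimum $v>0$, let $\underline X_t=v\wedge\inf_{0\le s\le t}X(s)$, $Y_t=X(t)-\underline X_t$, $\tau_a=\inf\{t\ge0:Y_t\ge a\}$. $\mathbb E_{(x,v),i}$ denotes expectation given $X(0)=x$, $\underline X_0=v$, $J(0)=i$.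 Define $$(H_a(v))_{ij}=\mathbb E_{(v,v),i}\big[e^{-w\tau_a};\tau_a<\infty,\ J(\tau_a)=j\big].$$ Let $\tau_{\uparrow v+a}=\inf\{t\ge0:X(t)\ge v+a\}$ and $\rho_v=\inf\{t>0:X(t)<v\}$. For bounded Borel $G:(0,\infty)\to\mathbb R^{m\times m}$ define $(\mathcal T_aG)(v)=Z^{+}(v)+(\mathcal V_aG)(v)$, where $$Z^{+}_{ij}(v)=\mathbb E_{(v,v),i}\big[e^{-w\tau_{\uparrow v+a}};\tau_{\uparrow v+a}<\rho_v,\ J(\tau_{\uparrow v+a})=j\big],$$ $$(\mathcal V_aG)_{ij}(v)=\mathbb E_{(v,v),i}\big[e^{-w\rho_v}G_{J(\rho_v),j}(X(\rho_v));\ \rho_v<\tau_{\uparrow v+a}\big].$$ *)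

theory Defs
  imports "HOL-Probability.Probability"
begin

text \<open>
  The finite phase space is a type \<open>'m::finite\<close>.  The parameters are \<open>c\<close> (inverse slopes),
  \<open>lam\<close> (jump rates), \<open>p\<close> (level reduction factors) and \<open>Q\<close> (phase transition matrix).
\<close>

definition stochastic_matrix :: "real ^ 'm ^ 'm \<Rightarrow> bool" where
  "stochastic_matrix Q \<longleftrightarrow> (\<forall>i j. 0 \<le> Q $ i $ j) \<and> (\<forall>i. (\<Sum>j\<in>UNIV. Q $ i $ j) = 1)"

text \<open>
  The process is built on a space of independent marks.  The \<open>n\<close>-th mark \<open>\<omega> !! n\<close> offers for every
  phase \<open>i\<close> a pair of a holding time with law Exp(\<open>lam i\<close>) and an independent next phase with law
  \<open>Q $ i\<close>; only the pair offered for the phase occupied after the \<open>n\<close>-th jump is used.  The same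
  probability space serves all initial states, so that the expectation for the initial state
  \<open>((x, v), i)\<close> is an integral over \<open>mark_space\<close> of a functional of the path started there.

  The measure is completed because the functionals of the path used below are well-behaved only
  off the null set of marks with a nonpositive holding time or with accumulating jump times.
\<close>

definition mark_law :: "('m::finite \<Rightarrow> real) \<Rightarrow> real ^ 'm ^ 'm \<Rightarrow> 'm \<Rightarrow> (real \<times> 'm) measure" where
  "mark_law lam Q i =
     density lborel (\<lambda>s. ennreal (exponential_density (lam i) s))
     \<Otimes>\<^sub>M measure_pmf (embed_pmf (\<lambda>j. Q $ i $ j))"

definition mark_space ::
  "('m::finite \<Rightarrow> real) \<Rightarrow> real ^ 'm ^ 'm \<Rightarrow> ('m \<Rightarrow> real \<times> 'm) stream measure" where
  "mark_space lam Q = completion (stream_space (PiM UNIV (mark_law lam Q)))"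

text \<open>
  \<open>skeleton c p x i \<omega> n\<close> is the triple of the \<open>n\<close>-th jump time and the level and phase immediately
  after that jump, with time \<open>0\<close> counted as the zeroth jump.
\<close>

primrec skeleton ::
  "('m \<Rightarrow> real) \<Rightarrow> ('m \<Rightarrow> real) \<Rightarrow> real \<Rightarrow> 'm \<Rightarrow> ('m \<Rightarrow> real \<times> 'm) stream \<Rightarrow> nat \<Rightarrow> real \<times> real \<times> 'm"
where
  "skeleton c p x i \<omega> 0 = (0, x, i)"
| "skeleton c p x i \<omega> (Suc n) =
     (let (t, y, k) = skeleton c p x i \<omega> n; (s, j) = (\<omega> !! n) k
      in (t + s, p k * (y + s / c k), j))"

definition num_jumps ::
  "('m \<Rightarrow> real) \<Rightarrow> ('m \<Rightarrow> real) \<Rightarrow> real \<Rightarrow> 'm \<Rightarrow> ('m \<Rightarrow> real \<times> 'm) stream \<Rightarrow> real \<Rightarrow> nat" where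
  "num_jumps c p x i \<omega> t = (LEAST n. t < fst (skeleton c p x i \<omega> (Suc n)))"

definition level ::
  "('m \<Rightarrow> real) \<Rightarrow> ('m \<Rightarrow> real) \<Rightarrow> real \<Rightarrow> 'm \<Rightarrow> ('m \<Rightarrow> real \<times> 'm) stream \<Rightarrow> real \<Rightarrow> real" where
  "level c p x i \<omega> t =
     (let (u, y, k) = skeleton c p x i \<omega> (num_jumps c p x i \<omega> t) in y + (t - u) / c k)"

definition phase ::
  "('m \<Rightarrow> real) \<Rightarrow> ('m \<Rightarrow> real) \<Rightarrow> real \<Rightarrow> 'm \<Rightarrow> ('m \<Rightarrow> real \<times> 'm) stream \<Rightarrow> real \<Rightarrow> 'm" where
  "phase c p x i \<omega> t = snd (snd (skeleton c p x i \<omega> (num_jumps c p x i \<omega> t)))"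

definition running_min :: "real \<Rightarrow> (real \<Rightarrow> real) \<Rightarrow> real \<Rightarrow> real" where
  "running_min v X t = min v (INF s\<in>{0..t}. X s)"

text \<open>The times below are extended reals, with value \<open>\<infinity>\<close> for the infimum of the empty set.\<close>

definition drawup_time :: "real \<Rightarrow> real \<Rightarrow> (real \<Rightarrow> real) \<Rightarrow> ereal" where
  "drawup_time a v X = (INF t\<in>{t. 0 \<le> t \<and> a \<le> X t - running_min v X t}. ereal t)"

definition up_time :: "real \<Rightarrow> (real \<Rightarrow> real) \<Rightarrow> ereal" where
  "up_time b X = (INF t\<in>{t. 0 \<le> t \<and> b \<le> X t}. ereal t)"

definition down_time :: "real \<Rightarrow> (real \<Rightarrow> real) \<Rightarrow> ereal" where
  "down_time v X = (INF t\<in>{t. 0 < t \<and> X t < v}. ereal t)"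

definition H_mat ::
  "('m::finite \<Rightarrow> real) \<Rightarrow> ('m \<Rightarrow> real) \<Rightarrow> ('m \<Rightarrow> real) \<Rightarrow> real ^ 'm ^ 'm \<Rightarrow> real \<Rightarrow> real
     \<Rightarrow> real \<Rightarrow> real ^ 'm ^ 'm" where
  "H_mat c lam p Q w a v = (\<chi> i j.
     \<integral>\<omega>. (let \<tau> = drawup_time a v (level c p v i \<omega>) in
          if \<tau> < \<infinity> \<and> phase c p v i \<omega> (real_of_ereal \<tau>) = j
          then exp (- w * real_of_ereal \<tau>) else 0) \<partial>mark_space lam Q)"

definition Z_plus ::
  "('m::finite \<Rightarrow> real) \<Rightarrow> ('m \<Rightarrow> real) \<Rightarrow> ('m \<Rightarrow> real) \<Rightarrow> real ^ 'm ^ 'm \<Rightarrow> real \<Rightarrow> real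
     \<Rightarrow> real \<Rightarrow> real ^ 'm ^ 'm" where
  "Z_plus c lam p Q w a v = (\<chi> i j.
     \<integral>\<omega>. (let X = level c p v i \<omega>; \<sigma> = up_time (v + a) X; \<rho> = down_time v X in
          if \<sigma> < \<rho> \<and> phase c p v i \<omega> (real_of_ereal \<sigma>) = j
          then exp (- w * real_of_ereal \<sigma>) else 0) \<partial>mark_space lam Q)"

definition V_op ::
  "('m::finite \<Rightarrow> real) \<Rightarrow> ('m \<Rightarrow> real) \<Rightarrow> ('m \<Rightarrow> real) \<Rightarrow> real ^ 'm ^ 'm \<Rightarrow> real \<Rightarrow> real
     \<Rightarrow> (real \<Rightarrow> real ^ 'm ^ 'm) \<Rightarrow> real \<Rightarrow> real ^ 'm ^ 'm" where
  "V_op c lam p Q w a G v = (\<chi> i j.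
     \<integral>\<omega>. (let X = level c p v i \<omega>; \<sigma> = up_time (v + a) X; \<rho> = down_time v X in
          if \<rho> < \<sigma>
          then exp (- w * real_of_ereal \<rho>)
                 * G (X (real_of_ereal \<rho>)) $ phase c p v i \<omega> (real_of_ereal \<rho>) $ j
          else 0) \<partial>mark_space lam Q)"

definition T_op ::
  "('m::finite \<Rightarrow> real) \<Rightarrow> ('m \<Rightarrow> real) \<Rightarrow> ('m \<Rightarrow> real) \<Rightarrow> real ^ 'm ^ 'm \<Rightarrow> real \<Rightarrow> real
     \<Rightarrow> (real \<Rightarrow> real ^ 'm ^ 'm) \<Rightarrow> real \<Rightarrow> real ^ 'm ^ 'm" where
  "T_op c lam p Q w a G v = Z_plus c lam p Q w a v + V_op c lam p Q w a G v"

definition beta :: "('m::finite \<Rightarrow> real) \<Rightarrow> ('m \<Rightarrow> real) \<Rightarrow> real \<Rightarrow> real \<Rightarrow> real" where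
  "beta c lam w a =
     Max (range (\<lambda>i. lam i / (w + lam i) * (1 - exp (- (c i * (lam i + w)) * a))))"

text \<open>
  Functions on \<open>(0, \<infinity>)\<close> are represented by functions on \<open>real\<close> whose values outside
  \<open>{0<..}\<close> are irrelevant.
\<close>

definition bounded_Borel :: "(real \<Rightarrow> real ^ 'm ^ 'm) \<Rightarrow> bool" where
  "bounded_Borel G \<longleftrightarrow>
     G \<in> borel_measurable (restrict_space borel {0<..}) \<and> bounded (G ` {0<..})"

definition mat_norm :: "real ^ 'm ^ 'm \<Rightarrow> real" where
  "mat_norm M = Max (range (\<lambda>i. \<Sum>j\<in>UNIV. \<bar>M $ i $ j\<bar>))"

text \<open>The supremum is taken in the extended reals, so that it is meaningful without boundedness.\<close>

definition sup_norm :: "(real \<Rightarrow> real ^ 'm ^ 'm) \<Rightarrow> ereal" where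
  "sup_norm G = (SUP v\<in>{0<..}. ereal (mat_norm (G v)))"

end

theory Submission imports Defs
begin

text \<open>
  Conditioning on the first jump gives, path by path, a recursion for the discounted draw-up reward
  and for the discounted two-sided exit rewards, started from a level \<open>x\<close> with running minimum
  \<open>v \<le> x\<close>.  Off a null set the recursion forces each of these rewards to be the limit of explicit
  measurable iterates, and in expectation it becomes a one-jump equation.  The expected discount at a
  first jump that precedes the crossing of level \<open>v + a\<close> is at most \<open>\<beta> < 1\<close>, so bounded solutions of
  this equation are unique; this identifies \<open>H\<close> with \<open>T_op H\<close> and makes \<open>T_op\<close> a \<open>\<beta>\<close>-contraction.
\<close>

section \<open>The path after the first jump\<close>

text \<open>The obstacle is measurability. \<open>H_mat\<close>, \<open>Z_plus\<close> and
  \<open>V_op\<close> integrate functionals built from infima over uncountable time sets along a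
  path whose jump count is a \<open>LEAST\<close>, while splitting off the first jump requires
  measurability jointly in the starting state and the marks. Each functional therefore enters only
  through its first-jump recursion, and all measurable objects are made from the iterates of that
  recursion. The state has to be a pair: a jump that stays above the running minimum changes the
  level and keeps \<open>v\<close>, so the recursion leaves the diagonal \<open>x = v\<close> on
  which \<open>H\<close> is defined. In phase \<open>i\<close> the linear ascent from
  \<open>(x, v)\<close> needs time \<open>c i * (v + a - x)\<close> to reach \<open>v + a\<close>,
  which is at most \<open>c i * a\<close> because \<open>v \<le> x\<close>. For an exponential
  holding time \<open>S\<close> of rate \<open>lam i\<close>, the expectation of
  \<open>exp (- w * S)\<close> on \<open>S \<le> c i * a\<close> is the \<open>i\<close>-th term of
  the maximum \<open>beta\<close>. One constant thus serves all states, on and off the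
  diagonal.\<close>

definition min_hold :: "('m::finite \<Rightarrow> real \<times> 'm) \<Rightarrow> real" where
  "min_hold f = Min (range (\<lambda>k. fst (f k)))"

text \<open>Both conditions concern the holding times offered to all phases, not those used by one
  path. A single exceptional set then serves all initial states, and goodness passes to
  \<open>stl \<omega>\<close>, along which the recursions run.\<close>

definition good :: "('m::finite \<Rightarrow> real \<times> 'm) stream \<Rightarrow> bool" where
  "good \<omega> \<longleftrightarrow> (\<forall>n k. 0 < fst ((\<omega> !! n) k))
     \<and> filterlim (\<lambda>n. \<Sum>l<n. min_hold (\<omega> !! l)) at_top sequentially"

lemma min_hold_le: "min_hold f \<le> fst (f k)"
  by (simp add: min_hold_def)

lemma good_shd: "good \<omega> \<Longrightarrow> 0 < fst (shd \<omega> k)"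
  unfolding good_def by (metis snth.simps(1))

lemma min_hold_sum_shift:
  "(\<Sum>l<Suc n. min_hold (\<omega> !! l)) = min_hold (shd \<omega>) + (\<Sum>l<n. min_hold (stl \<omega> !! l))"
  by (subst sum.lessThan_Suc_shift) simp

lemma good_iff:
  "good \<omega> \<longleftrightarrow> (\<forall>k. 0 < fst (shd \<omega> k)) \<and> good (stl \<omega>)"
proof -
  have "(\<forall>n k. 0 < fst ((\<omega> !! n) k)) \<longleftrightarrow>
      (\<forall>k. 0 < fst (shd \<omega> k)) \<and> (\<forall>n k. 0 < fst ((stl \<omega> !! n) k))"
    by (metis not0_implies_Suc snth.simps)
  moreover have "filterlim (\<lambda>n. \<Sum>l<n. min_hold (\<omega> !! l)) at_top sequentially \<longleftrightarrow>
      filterlim (\<lambda>n. \<Sum>l<n. min_hold (stl \<omega> !! l)) at_top sequentially" (is "?L \<longleftrightarrow> ?R")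
  proof -
    have "?L \<longleftrightarrow> filterlim (\<lambda>n. \<Sum>l<Suc n. min_hold (\<omega> !! l)) at_top sequentially"
      by (rule filterlim_sequentially_Suc[symmetric])
    also have "\<dots> \<longleftrightarrow> filterlim (\<lambda>n. min_hold (shd \<omega>) + (\<Sum>l<n. min_hold (stl \<omega> !! l))) at_top sequentially"
      by (simp only: min_hold_sum_shift)
    also have "\<dots> \<longleftrightarrow> ?R"
    proof
      assume "filterlim (\<lambda>n. min_hold (shd \<omega>) + (\<Sum>l<n. min_hold (stl \<omega> !! l))) at_top sequentially"
      from filterlim_tendsto_add_at_top[OF tendsto_const this, of "- min_hold (shd \<omega>)"]
      show ?R by simp
    qed (rule filterlim_tendsto_add_at_top[OF tendsto_const])
    finally show ?thesis .
  qed
  ultimately show ?thesis unfolding good_def by blast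
qed

lemma good_stl: "good \<omega> \<Longrightarrow> good (stl \<omega>)"
  by (simp add: good_iff[of \<omega>])

text \<open>\<open>skeleton\<close> appends jumps at the end, whereas conditioning removes the first
  one. What remains is a fresh path from the post-jump state, driven by \<open>stl \<omega>\<close>
  and delayed by the first holding time.\<close>

lemma skeleton_shift:
  "skeleton c p x i \<omega> (Suc n) =
     (let s = fst (shd \<omega> i);
          (t, y, k) = skeleton c p (p i * (x + s / c i)) (snd (shd \<omega> i)) (stl \<omega>) n
      in (s + t, y, k))"
  by (induction n) (simp_all add: Let_def split_beta)

lemma skeleton_time_shift:
  "fst (skeleton c p x i \<omega> (Suc n)) = fst (shd \<omega> i)
     + fst (skeleton c p (p i * (x + fst (shd \<omega> i) / c i)) (snd (shd \<omega> i)) (stl \<omega>) n)"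
  by (simp only: skeleton_shift Let_def split_beta fst_conv)

lemma skeleton_time_ge:
  "(\<Sum>l<n. min_hold (\<omega> !! l)) \<le> fst (skeleton c p x i \<omega> n)"
proof (induction n)
  case (Suc n)
  show ?case
    using add_mono[OF Suc.IH min_hold_le[of "\<omega> !! n" "snd (snd (skeleton c p x i \<omega> n))"]]
    by (simp add: Let_def split_beta)
qed simp

lemma exists_jump_after:
  assumes "good \<omega>" shows "\<exists>n. t < fst (skeleton c p x i \<omega> (Suc n))"
proof -
  have "filterlim (\<lambda>n. \<Sum>l<Suc n. min_hold (\<omega> !! l)) at_top sequentially"
    using assms unfolding good_def by (intro filterlim_sequentially_Suc[THEN iffD2]) blast
  then have "\<forall>\<^sub>F n in sequentially. t < (\<Sum>l<Suc n. min_hold (\<omega> !! l))"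
    unfolding filterlim_at_top_dense by blast
  then obtain n where "t < (\<Sum>l<Suc n. min_hold (\<omega> !! l))"
    using eventually_happens'[OF sequentially_bot] by blast
  with skeleton_time_ge[of \<omega> "Suc n" c p x i] show ?thesis
    by (intro exI[of _ n]) linarith
qed

text \<open>On a good stream the jump times exceed every bound, so the \<open>LEAST\<close> in
  \<open>num_jumps\<close> is attained and its candidate \<open>0\<close> can be split off.\<close>

lemma num_jumps_shift:
  assumes "good \<omega>"
  shows "num_jumps c p x i \<omega> t = (if t < fst (shd \<omega> i) then 0 else
    Suc (num_jumps c p (p i * (x + fst (shd \<omega> i) / c i)) (snd (shd \<omega> i)) (stl \<omega>) (t - fst (shd \<omega> i))))"
proof (cases "t < fst (shd \<omega> i)")
  case True
  then show ?thesis
    unfolding num_jumps_def by (auto simp: Let_def split_beta intro!: Least_eq_0)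
next
  case False
  obtain n where n: "t < fst (skeleton c p x i \<omega> (Suc n))" using exists_jump_after[OF assms] by blast
  have "num_jumps c p x i \<omega> t = Suc (LEAST m. t < fst (skeleton c p x i \<omega> (Suc (Suc m))))"
    unfolding num_jumps_def using n False
    by (intro Least_Suc[of _ n]) (auto simp: Let_def split_beta)
  also have "(\<lambda>m. t < fst (skeleton c p x i \<omega> (Suc (Suc m)))) =
    (\<lambda>m. t - fst (shd \<omega> i) < fst (skeleton c p (p i * (x + fst (shd \<omega> i) / c i)) (snd (shd \<omega> i)) (stl \<omega>) (Suc m)))"
    by (simp only: skeleton_time_shift[of c p x i \<omega> "Suc _"]) (auto simp: algebra_simps)
  finally show ?thesis using False by (simp add: num_jumps_def)
qed

lemma level_shift:
  assumes "good \<omega>"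
  shows "level c p x i \<omega> t = (if t < fst (shd \<omega> i) then x + t / c i else
    level c p (p i * (x + fst (shd \<omega> i) / c i)) (snd (shd \<omega> i)) (stl \<omega>) (t - fst (shd \<omega> i)))"
  using assms
  by (simp add: level_def num_jumps_shift skeleton_shift Let_def split_beta diff_diff_eq
      del: skeleton.simps(2))

lemma phase_shift:
  assumes "good \<omega>"
  shows "phase c p x i \<omega> t = (if t < fst (shd \<omega> i) then i else
    phase c p (p i * (x + fst (shd \<omega> i) / c i)) (snd (shd \<omega> i)) (stl \<omega>) (t - fst (shd \<omega> i)))"
  using assms
  by (simp add: phase_def num_jumps_shift skeleton_shift Let_def split_beta
      del: skeleton.simps(2))

text \<open>Has two uses: it bounds the path below, so that the \<open>INF\<close> in
  \<open>running_min\<close> is a true infimum, and it guarantees that matrix functions are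
  evaluated on \<open>{0<..}\<close> only.\<close>

lemma level_pos:
  fixes c p :: "'m::finite \<Rightarrow> real"
  assumes "good \<omega>" "0 < x" "0 \<le> t" and c: "\<And>k. 0 < c k" and p: "\<And>k. 0 < p k"
  shows "0 < level c p x i \<omega> t"
proof -
  have y: "0 < fst (snd (skeleton c p x i \<omega> n))" for n
  proof (induction n)
    case (Suc n)
    have "0 < fst ((\<omega> !! n) k)" for k using assms(1) unfolding good_def by blast
    with Suc c p show ?case
      by (simp add: Let_def split_beta add_pos_pos)
  qed (use assms in simp)
  have "fst (skeleton c p x i \<omega> (num_jumps c p x i \<omega> t)) \<le> t"
  proof (cases "num_jumps c p x i \<omega> t")
    case (Suc m)
    then have "m < (LEAST n. t < fst (skeleton c p x i \<omega> (Suc n)))" by (simp add: num_jumps_def)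
    from not_less_Least[OF this] show ?thesis using Suc by simp
  qed (use assms in simp)
  with y c show ?thesis
    by (simp add: level_def Let_def split_beta add_pos_nonneg less_imp_le)
qed

section \<open>Passage times of a path with a linear first sojourn\<close>

lemma INF_ereal_shift:
  assumes "S \<subseteq> {0..}"
  shows "(INF t\<in>(\<lambda>r. s + r) ` S. ereal t) = ereal s + (INF r\<in>S. ereal r)"
proof (cases "S = {}")
  case True then show ?thesis by (simp add: top_ereal_def)
next
  case False
  have "(INF t\<in>(\<lambda>r. s + r) ` S. ereal t) = (INF r\<in>S. ereal s + ereal r)"
    by (simp add: image_image)
  also have "\<dots> = ereal s + (INF r\<in>S. ereal r)"
  proof (rule INF_ereal_add_right[OF False])
    show "ereal s \<noteq> -\<infinity>" by simp
    show "0 \<le> ereal r" if "r \<in> S" for r using that assms by auto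
  qed
  finally show ?thesis .
qed

lemma INF_ereal_Min:
  assumes "u \<in> S" "\<And>t. t \<in> S \<Longrightarrow> u \<le> t"
  shows "(INF t\<in>S. ereal t) = ereal u"
  by (rule antisym) (use assms in \<open>auto intro: INF_lower INF_greatest\<close>)

text \<open>All that the three passage times see of the first jump: a linear ascent with slope
  \<open>1 / k\<close>, then an arbitrary continuation. Time \<open>s\<close> belongs to the
  continuation, so the ascent covers a half-open interval.\<close>

locale first_sojourn =
  fixes X X' :: "real \<Rightarrow> real" and s x k :: real
  assumes X: "\<And>t. X t = (if t < s then x + t / k else X' (t - s))"
    and s: "0 < s" and k: "0 < k"
begin

text \<open>The ascent would meet \<open>b\<close> at time \<open>k * (b - x)\<close>. The
  comparison with \<open>s\<close> is strict because in case of equality the jump takes place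
  instead and \<open>b\<close> is not attained.\<close>

lemma up_time_first:
  assumes "x < b"
  shows "up_time b X = (if k * (b - x) < s then ereal (k * (b - x)) else ereal s + up_time b X')"
proof (cases "k * (b - x) < s")
  case True
  have "up_time b X = ereal (k * (b - x))"
    unfolding up_time_def
  proof (rule INF_ereal_Min)
    show "k * (b - x) \<in> {t. 0 \<le> t \<and> b \<le> X t}" using True k assms by (simp add: X)
    fix t assume "t \<in> {t. 0 \<le> t \<and> b \<le> X t}"
    with True k show "k * (b - x) \<le> t" by (auto simp: X field_simps split: if_splits)
  qed
  with True show ?thesis by simp
next
  case False
  have "{t. 0 \<le> t \<and> b \<le> X t} = (\<lambda>r. s + r) ` {r. 0 \<le> r \<and> b \<le> X' r}"
  proof (intro set_eqI iffI)
    fix t assume t: "t \<in> {t. 0 \<le> t \<and> b \<le> X t}"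
    have "s \<le> t"
    proof (rule ccontr)
      assume "\<not> s \<le> t"
      then have "b \<le> x + t / k" "t < s" using t by (auto simp: X)
      with False k show False by (simp add: field_simps)
    qed
    with t show "t \<in> (\<lambda>r. s + r) ` {r. 0 \<le> r \<and> b \<le> X' r}"
      by (intro image_eqI[of _ _ "t - s"]) (auto simp: X)
  qed (use s in \<open>auto simp: X\<close>)
  then show ?thesis using False
    by (simp add: up_time_def) (subst INF_ereal_shift, auto)
qed

text \<open>An ascent from \<open>x \<ge> v\<close> cannot pass below \<open>v\<close> before
  \<open>s\<close>. The value \<open>X' 0\<close> needs its own case: \<open>down_time\<close>
  ranges over strictly positive times, so the down time of \<open>X'\<close> ignores it.\<close>

lemma down_time_first:
  assumes "v \<le> x"
  shows "down_time v X = (if X' 0 < v then ereal s else ereal s + down_time v X')"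
proof -
  have ge: "s \<le> t" if "0 < t" "X t < v" for t
  proof (rule ccontr)
    assume "\<not> s \<le> t"
    with that have "x + t / k < v" by (auto simp: X)
    moreover have "0 < t / k" using that k by simp
    ultimately show False using assms by linarith
  qed
  show ?thesis
  proof (cases "X' 0 < v")
    case True
    have "down_time v X = ereal s" unfolding down_time_def
      by (rule INF_ereal_Min) (use True s ge in \<open>auto simp: X\<close>)
    with True show ?thesis by simp
  next
    case False
    have "{t. 0 < t \<and> X t < v} = (\<lambda>r. s + r) ` {r. 0 < r \<and> X' r < v}"
    proof (intro set_eqI iffI)
      fix t assume t: "t \<in> {t. 0 < t \<and> X t < v}"
      then have "s \<le> t" using ge by auto
      moreover have "t \<noteq> s" using t False s by (auto simp: X)
      ultimately show "t \<in> (\<lambda>r. s + r) ` {r. 0 < r \<and> X' r < v}"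
        using t by (intro image_eqI[of _ _ "t - s"]) (auto simp: X)
    qed (use s in \<open>auto simp: X\<close>)
    then show ?thesis using False
      by (simp add: down_time_def) (subst INF_ereal_shift, auto)
  qed
qed

text \<open>Before \<open>s\<close> the running minimum stays at \<open>v\<close>, so a draw-up of
  size \<open>a\<close> means reaching \<open>v + a\<close>. Afterwards the past matters only
  through \<open>min v (X' 0)\<close>; including \<open>X' 0\<close> leaves the later running
  minimum unchanged and puts the new level at or above the new minimum.\<close>

lemma drawup_time_first:
  assumes "v \<le> x" "x < v + a" and pos: "\<And>r. 0 \<le> r \<Longrightarrow> 0 < X' r"
  shows "drawup_time a v X = (if k * (v + a - x) < s then ereal (k * (v + a - x))
     else ereal s + drawup_time a (min v (X' 0)) X')"
proof -
  have run1: "running_min v X t = v" if "0 \<le> t" "t < s" for t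
  proof -
    have "v \<le> (INF u\<in>{0..t}. X u)"
    proof (rule cINF_greatest)
      fix u assume u: "u \<in> {0..t}"
      then have "0 \<le> u / k" using k by simp
      then show "v \<le> X u" using u that assms(1) by (auto simp: X)
    qed (use that in simp)
    then show ?thesis by (simp add: running_min_def)
  qed
  have run2: "running_min v X t = running_min (min v (X' 0)) X' (t - s)" if t: "s \<le> t" for t
  proof -
    have split: "X ` {0..t} = (\<lambda>u. x + u / k) ` {0..<s} \<union> X' ` {0..t - s}"
    proof -
      have "{0..t} = {0..<s} \<union> (\<lambda>r. s + r) ` {0..t - s}"
        unfolding image_add_atLeastAtMost using s t by auto
      then have "X ` {0..t} = X ` {0..<s} \<union> X ` (\<lambda>r. s + r) ` {0..t - s}" by (simp only: image_Un)
      also have "X ` {0..<s} = (\<lambda>u. x + u / k) ` {0..<s}" by (intro image_cong) (simp_all add: X)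
      also have "X ` (\<lambda>r. s + r) ` {0..t - s} = X' ` {0..t - s}"
        unfolding image_image by (intro image_cong) (simp_all add: X)
      finally show ?thesis .
    qed
    have bdd': "bdd_below (X' ` {0..t - s})"
      by (rule bdd_belowI2[of _ 0]) (simp add: pos less_imp_le)
    have ge: "x \<le> x + u / k" if "u \<in> {0..<s}" for u using that k by simp
    have bdd1: "bdd_below ((\<lambda>u. x + u / k) ` {0..<s})"
      using ge by (rule bdd_belowI2)
    have "Inf ((\<lambda>u. x + u / k) ` {0..<s}) = x"
    proof (rule cInf_eq_minimum)
      show "x \<in> (\<lambda>u. x + u / k) ` {0..<s}" using s by (intro image_eqI[of _ _ 0]) auto
    qed (use ge in auto)
    then have "(INF u\<in>{0..t}. X u) = inf x (INF u\<in>{0..t - s}. X' u)"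
      unfolding split using bdd' bdd1 s t by (subst cInf_union_distrib) auto
    moreover have "(INF u\<in>{0..t - s}. X' u) \<le> X' 0"
      using t by (intro cINF_lower bdd') auto
    ultimately show ?thesis using assms(1)
      by (simp add: running_min_def inf_real_def)
  qed
  show ?thesis
  proof (cases "k * (v + a - x) < s")
    case True
    have "drawup_time a v X = ereal (k * (v + a - x))" unfolding drawup_time_def
    proof (rule INF_ereal_Min)
      show "k * (v + a - x) \<in> {t. 0 \<le> t \<and> a \<le> X t - running_min v X t}"
        using True k assms run1[of "k * (v + a - x)"] by (simp add: X)
      fix t assume t: "t \<in> {t. 0 \<le> t \<and> a \<le> X t - running_min v X t}"
      show "k * (v + a - x) \<le> t"
      proof (cases "t < s")
        case True
        with t run1[of t] have "a \<le> x + t / k - v" by (simp add: X)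
        with k show ?thesis by (simp add: field_simps)
      qed (use True in simp)
    qed
    with True show ?thesis by simp
  next
    case False
    have "{t. 0 \<le> t \<and> a \<le> X t - running_min v X t} =
      (\<lambda>r. s + r) ` {r. 0 \<le> r \<and> a \<le> X' r - running_min (min v (X' 0)) X' r}"
    proof (intro set_eqI iffI)
      fix t assume t: "t \<in> {t. 0 \<le> t \<and> a \<le> X t - running_min v X t}"
      have "s \<le> t"
      proof (rule ccontr)
        assume ts: "\<not> s \<le> t"
        then have "a \<le> x + t / k - v" "t < s" using t run1[of t] by (auto simp: X)
        with False k show False by (simp add: field_simps)
      qed
      with t run2[of t] show "t \<in> (\<lambda>r. s + r) ` {r. 0 \<le> r \<and> a \<le> X' r - running_min (min v (X' 0)) X' r}"
        by (intro image_eqI[of _ _ "t - s"]) (auto simp: X)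
    qed (use s run2 in \<open>auto simp: X\<close>)
    then show ?thesis using False
      by (simp add: drawup_time_def) (subst INF_ereal_shift, auto)
  qed
qed

end

lemma up_time_nonneg: "0 \<le> up_time b X"
  unfolding up_time_def by (rule INF_greatest) simp

lemma down_time_nonneg: "0 \<le> down_time v X"
  unfolding down_time_def by (rule INF_greatest) simp

lemma drawup_time_nonneg: "0 \<le> drawup_time a v X"
  unfolding drawup_time_def by (rule INF_greatest) simp

section \<open>Functionals of the path with a first-jump recursion\<close>

locale jump_model =
  fixes c lam p :: "'m::finite \<Rightarrow> real" and Q :: "real ^ 'm ^ 'm" and w a :: real
  assumes c: "\<And>i. 0 < c i" and lam: "\<And>i. 0 < lam i" and p: "\<And>i. 0 < p i" "\<And>i. p i < 1"
    and w: "0 < w" and a: "0 < a"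
begin

text \<open>The states that occur before the draw-up is completed. They keep the crossing time
  \<open>c i * (v + a - x)\<close> positive and at most \<open>c i * a\<close>.\<close>

definition start_ok :: "real \<Rightarrow> real \<Rightarrow> bool" where
  "start_ok x v \<longleftrightarrow> 0 < v \<and> v \<le> x \<and> x < v + a"

text \<open>
  \<open>R\<close> is the reward for reaching \<open>v + a\<close> and \<open>G\<close> the one for passing below the running minimum \<open>v\<close>;
  \<open>\<theta> = 1\<close> restarts the path from its new minimum at such a passage, and \<open>\<theta> = 0\<close> kills it there.
\<close>

definition jump_step :: "real \<Rightarrow> ('m \<Rightarrow> real) \<Rightarrow> (real \<Rightarrow> 'm \<Rightarrow> real) \<Rightarrow> real \<Rightarrow> real \<Rightarrow> 'm
    \<Rightarrow> real \<times> 'm \<Rightarrow> (real \<Rightarrow> real \<Rightarrow> 'm \<Rightarrow> real) \<Rightarrow> real" where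
  "jump_step \<theta> R G x v i m h =
     (if c i * (v + a - x) < fst m then exp (- w * (c i * (v + a - x))) * R i
      else exp (- w * fst m) *
        (if p i * (x + fst m / c i) < v
         then G (p i * (x + fst m / c i)) (snd m)
           + \<theta> * h (p i * (x + fst m / c i)) (p i * (x + fst m / c i)) (snd m)
         else h (p i * (x + fst m / c i)) v (snd m)))"

lemma start_ok_diag: "0 < v \<Longrightarrow> start_ok v v"
  using a by (simp add: start_ok_def)

lemma after_jump_pos:
  assumes "start_ok x v" "0 < s" shows "0 < p i * (x + s / c i)"
  using assms c[of i] p(1)[of i] by (simp add: start_ok_def add_pos_pos)

text \<open>Without a crossing only \<open>x + s / c i \<le> v + a\<close> is known; the strict
  inequality after the jump comes from \<open>p i < 1\<close>.\<close>

lemma start_ok_step: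
  assumes "start_ok x v" "0 < s" "\<not> c i * (v + a - x) < s"
  shows "start_ok (p i * (x + s / c i)) (min v (p i * (x + s / c i)))"
proof -
  have "x + s / c i \<le> v + a" using assms(3) c[of i] by (simp add: field_simps)
  moreover have "0 < x + s / c i" using assms c[of i] by (simp add: start_ok_def add_pos_pos)
  then have "p i * (x + s / c i) < x + s / c i" using p(2)[of i] by simp
  ultimately show ?thesis
    using after_jump_pos[OF assms(1,2), of i] a assms(1) by (auto simp: start_ok_def min_def)
qed

lemma start_ok_stepE:
  assumes "start_ok x v" "0 < s" "\<not> c i * (v + a - x) < s"
  shows "p i * (x + s / c i) < v \<Longrightarrow> start_ok (p i * (x + s / c i)) (p i * (x + s / c i))"
    and "\<not> p i * (x + s / c i) < v \<Longrightarrow> start_ok (p i * (x + s / c i)) v"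
  using start_ok_step[OF assms] by (auto simp: min_def split: if_splits)

lemma jump_step_cong:
  assumes "start_ok x v" "0 < fst m" "\<And>y. 0 < y \<Longrightarrow> G y (snd m) = G' y (snd m)"
    and "\<And>y u. start_ok y u \<Longrightarrow> h y u (snd m) = h' y u (snd m)"
  shows "jump_step \<theta> R G x v i m h = jump_step \<theta> R G' x v i m h'"
  using start_ok_stepE[OF assms(1,2), of i] after_jump_pos[OF assms(1,2), of i] assms(3,4)
  by (simp add: jump_step_def)

text \<open>The common interface of draw-up and exit rewards. The recursion determines the values on
  good streams and the bound \<open>B\<close> excludes other solutions; measurability is not part of
  it but a consequence.\<close>

definition jump_functional :: "real \<Rightarrow> ('m \<Rightarrow> real) \<Rightarrow> (real \<Rightarrow> 'm \<Rightarrow> real) \<Rightarrow> real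
    \<Rightarrow> (real \<Rightarrow> real \<Rightarrow> 'm \<Rightarrow> ('m \<Rightarrow> real \<times> 'm) stream \<Rightarrow> real) \<Rightarrow> bool" where
  "jump_functional \<theta> R G B \<Phi> \<longleftrightarrow> (\<forall>x v i \<omega>. good \<omega> \<longrightarrow> start_ok x v \<longrightarrow>
     \<bar>\<Phi> x v i \<omega>\<bar> \<le> B \<and>
     \<Phi> x v i \<omega> = jump_step \<theta> R G x v i (shd \<omega> i) (\<lambda>y u k. \<Phi> y u k (stl \<omega>)))"

text \<open>A general terminal reward \<open>R\<close> covers the indicator of a phase, giving
  single entries of \<open>H\<close>, and the constant \<open>1\<close>, giving its row
  sums.\<close>

definition drawup_fun :: "('m \<Rightarrow> real) \<Rightarrow> real \<Rightarrow> real \<Rightarrow> 'm \<Rightarrow> ('m \<Rightarrow> real \<times> 'm) stream \<Rightarrow> real" where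
  "drawup_fun R x v i \<omega> = (let \<tau> = drawup_time a v (level c p x i \<omega>) in
     if \<tau> < \<infinity> then exp (- w * real_of_ereal \<tau>) * R (phase c p x i \<omega> (real_of_ereal \<tau>)) else 0)"

text \<open>The barriers are tied to \<open>v\<close> and not to the starting level
  \<open>x\<close>, so that a jump landing at or above \<open>v\<close> leaves the exit problem the
  same.\<close>

definition up_fun :: "('m \<Rightarrow> real) \<Rightarrow> real \<Rightarrow> real \<Rightarrow> 'm \<Rightarrow> ('m \<Rightarrow> real \<times> 'm) stream \<Rightarrow> real" where
  "up_fun R x v i \<omega> =
     (let X = level c p x i \<omega>; \<sigma> = up_time (v + a) X; \<rho> = down_time v X in
      if \<sigma> < \<rho> then exp (- w * real_of_ereal \<sigma>) * R (phase c p x i \<omega> (real_of_ereal \<sigma>)) else 0)"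

definition down_fun :: "(real \<Rightarrow> 'm \<Rightarrow> real) \<Rightarrow> real \<Rightarrow> real \<Rightarrow> 'm \<Rightarrow> ('m \<Rightarrow> real \<times> 'm) stream \<Rightarrow> real" where
  "down_fun G x v i \<omega> =
     (let X = level c p x i \<omega>; \<sigma> = up_time (v + a) X; \<rho> = down_time v X in
      if \<rho> < \<sigma> then exp (- w * real_of_ereal \<rho>)
        * G (X (real_of_ereal \<rho>)) (phase c p x i \<omega> (real_of_ereal \<rho>)) else 0)"

lemma discount_bound:
  assumes "0 \<le> (\<tau>::ereal)" "\<bar>r\<bar> \<le> B" shows "\<bar>exp (- w * real_of_ereal \<tau>) * r\<bar> \<le> B"
proof -
  have "exp (- w * real_of_ereal \<tau>) \<le> 1"
    using w assms(1) by (simp add: real_of_ereal_pos)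
  then have "exp (- w * real_of_ereal \<tau>) * \<bar>r\<bar> \<le> 1 * B"
    using assms(2) by (intro mult_mono) auto
  then show ?thesis by (simp add: abs_mult)
qed

lemma first_sojourn_level:
  assumes "good \<omega>"
  shows "first_sojourn (level c p x i \<omega>)
    (level c p (p i * (x + fst (shd \<omega> i) / c i)) (snd (shd \<omega> i)) (stl \<omega>)) (fst (shd \<omega> i)) x (c i)"
  using level_shift[OF assms, of c p x i] good_shd[OF assms] c by unfold_locales auto

lemma level_0: "good \<omega> \<Longrightarrow> level c p x i \<omega> 0 = x"
  using good_shd[of \<omega> i] by (simp add: level_shift)

text \<open>Strictness fixes the order of the exit times: after a jump below \<open>v\<close> at
  time \<open>s\<close>, level \<open>v + a\<close> is reached later than \<open>s\<close>, so the
  reward in \<open>down_fun\<close> is paid.\<close>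

lemma up_time_pos:
  assumes "good \<omega>" "x < b" shows "0 < up_time b (level c p x i \<omega>)"
proof -
  interpret first_sojourn "level c p x i \<omega>"
    "level c p (p i * (x + fst (shd \<omega> i) / c i)) (snd (shd \<omega> i)) (stl \<omega>)" "fst (shd \<omega> i)" x "c i"
    by (rule first_sojourn_level[OF assms(1)])
  have "0 < ereal (fst (shd \<omega> i)) + up_time b Y" for Y
    using s up_time_nonneg[of b Y] by (simp add: add_pos_nonneg)
  then show ?thesis using assms(2) k by (simp add: up_time_first)
qed

text \<open>A jump below \<open>v\<close> restarts the draw-up problem on the diagonal, whence
  \<theta> is \<open>1\<close>; nothing is paid at that moment, whence the zero reward
  \<open>G\<close>.\<close>

lemma jump_functional_drawup:
  assumes R: "\<And>k. \<bar>R k\<bar> \<le> B"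
  shows "jump_functional 1 R (\<lambda>_ _. 0) B (drawup_fun R)"
  unfolding jump_functional_def
proof (intro allI impI conjI)
  fix x v i and \<omega> :: "('m \<Rightarrow> real \<times> 'm) stream" assume g: "good \<omega>" and xv: "start_ok x v"
  have B: "0 \<le> B" using R[of undefined] by linarith
  show "\<bar>drawup_fun R x v i \<omega>\<bar> \<le> B"
    using B by (simp add: Let_def drawup_fun_def discount_bound[OF drawup_time_nonneg R, simplified])
  define s k where "s = fst (shd \<omega> i)" and "k = snd (shd \<omega> i)"
  define y where "y = p i * (x + s / c i)"
  have s: "0 < s" using good_shd[OF g] by (simp add: s_def)
  have y: "0 < y" using after_jump_pos[OF xv s] by (simp add: y_def)
  interpret first_sojourn "level c p x i \<omega>" "level c p y k (stl \<omega>)" s x "c i"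
    unfolding y_def k_def s_def by (rule first_sojourn_level[OF g])
  have \<tau>: "drawup_time a v (level c p x i \<omega>) = (if c i * (v + a - x) < s then ereal (c i * (v + a - x))
     else ereal s + drawup_time a (min v y) (level c p y k (stl \<omega>)))"
    using drawup_time_first[of v a] xv level_pos[OF good_stl[OF g] y _ c p(1)]
    by (simp add: start_ok_def level_0[OF good_stl[OF g]])
  have ph: "phase c p x i \<omega> t = (if t < s then i else phase c p y k (stl \<omega>) (t - s))" for t
    using phase_shift[OF g, of c p x i] by (simp add: y_def s_def k_def)
  show "drawup_fun R x v i \<omega>
    = jump_step 1 R (\<lambda>_ _. 0) x v i (shd \<omega> i) (\<lambda>y u k. drawup_fun R y u k (stl \<omega>))"
  proof (cases "c i * (v + a - x) < s")
    case True
    then show ?thesis by (simp add: Let_def drawup_fun_def jump_step_def \<tau> ph flip: s_def)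
  next
    case False
    define \<tau>' where "\<tau>' = drawup_time a (min v y) (level c p y k (stl \<omega>))"
    \<comment> \<open>Both branches of \<open>jump_step\<close> after the jump amount to the single
      new state \<open>(y, min v y)\<close>, so one computation covers them.\<close>
    have "drawup_fun R x v i \<omega> = exp (- w * s) * drawup_fun R y (min v y) k (stl \<omega>)"
    proof (cases \<tau>')
      case (real r)
      then have "0 \<le> r" using drawup_time_nonneg[of a "min v y" "level c p y k (stl \<omega>)"] by (simp add: \<tau>'_def)
      with real False show ?thesis
        by (simp add: Let_def drawup_fun_def \<tau> ph flip: \<tau>'_def) (simp add: algebra_simps exp_diff exp_minus exp_add divide_simps)
    next
      case PInf
      with False show ?thesis by (simp add: Let_def drawup_fun_def \<tau> flip: \<tau>'_def)
    next
      case MInf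
      with drawup_time_nonneg[of a "min v y" "level c p y k (stl \<omega>)"] show ?thesis by (simp add: \<tau>'_def)
    qed
    with False show ?thesis
      by (auto simp: jump_step_def min_def y_def simp flip: s_def k_def)
  qed
qed

context
  fixes x v :: real and i :: 'm and \<omega> :: "('m \<Rightarrow> real \<times> 'm) stream" and s k y
  assumes g: "good \<omega>" and xv: "start_ok x v"
    and s_def: "s = fst (shd \<omega> i)" and k_def: "k = snd (shd \<omega> i)"
    and y_def: "y = p i * (x + s / c i)"
begin

text \<open>The bookkeeping shared by both exit recursions. The bound of \<open>down_time\<close> by
  \<open>ereal s\<close> expresses that a passage below \<open>v\<close> needs a jump, so a crossing
  of \<open>v + a\<close> during the first sojourn always wins.\<close>

private lemma exit_times:
  shows "up_time (v + a) (level c p x i \<omega>) = (if c i * (v + a - x) < s then ereal (c i * (v + a - x))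
     else ereal s + up_time (v + a) (level c p y k (stl \<omega>)))"
    and "down_time v (level c p x i \<omega>) =
     (if y < v then ereal s else ereal s + down_time v (level c p y k (stl \<omega>)))"
    and "phase c p x i \<omega> t = (if t < s then i else phase c p y k (stl \<omega>) (t - s))"
    and "level c p x i \<omega> t = (if t < s then x + t / c i else level c p y k (stl \<omega>) (t - s))"
    and "0 < s" and "y < v \<Longrightarrow> 0 < up_time (v + a) (level c p y k (stl \<omega>))"
    and "0 \<le> c i * (v + a - x)"
    and "ereal s \<le> down_time v (level c p x i \<omega>)"
proof -
  interpret first_sojourn "level c p x i \<omega>" "level c p y k (stl \<omega>)" s x "c i"
    unfolding y_def k_def s_def by (rule first_sojourn_level[OF g])
  show "up_time (v + a) (level c p x i \<omega>) = (if c i * (v + a - x) < s then ereal (c i * (v + a - x))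
     else ereal s + up_time (v + a) (level c p y k (stl \<omega>)))"
    using xv by (intro up_time_first) (simp add: start_ok_def)
  show d: "down_time v (level c p x i \<omega>) =
     (if y < v then ereal s else ereal s + down_time v (level c p y k (stl \<omega>)))"
    using down_time_first[of v] xv by (simp add: start_ok_def level_0[OF good_stl[OF g]])
  show "phase c p x i \<omega> t = (if t < s then i else phase c p y k (stl \<omega>) (t - s))"
    using phase_shift[OF g, of c p x i] by (simp add: y_def s_def k_def)
  show "level c p x i \<omega> t = (if t < s then x + t / c i else level c p y k (stl \<omega>) (t - s))"
    by (rule X)
  show "0 < s" by (rule s)
  show "y < v \<Longrightarrow> 0 < up_time (v + a) (level c p y k (stl \<omega>))"
    using a by (intro up_time_pos[OF good_stl[OF g]]) simp
  show "0 \<le> c i * (v + a - x)" using k xv by (simp add: start_ok_def)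
  have "ereal s + 0 \<le> ereal s + down_time v (level c p y k (stl \<omega>))"
    by (intro add_left_mono down_time_nonneg)
  then show "ereal s \<le> down_time v (level c p x i \<omega>)"
    by (simp add: d)
qed

private lemma up_fun_step:
  "up_fun R x v i \<omega> = jump_step 0 R (\<lambda>_ _. 0) x v i (shd \<omega> i) (\<lambda>y u k. up_fun R y u k (stl \<omega>))"
proof -
  define \<sigma>' where "\<sigma>' = up_time (v + a) (level c p y k (stl \<omega>))"
  define \<rho>' where "\<rho>' = down_time v (level c p y k (stl \<omega>))"
  have nn: "0 \<le> \<sigma>'" "0 \<le> \<rho>'" by (simp_all add: \<sigma>'_def \<rho>'_def up_time_nonneg down_time_nonneg)
  show ?thesis
  proof (cases "c i * (v + a - x) < s")
    case True
    then have "ereal (c i * (v + a - x)) < down_time v (level c p x i \<omega>)"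
      using exit_times(8) by (metis less_ereal.simps(1) order_less_le_trans)
    with True show ?thesis
      by (simp add: Let_def up_fun_def jump_step_def exit_times(1,3) flip: s_def)
  next
    case F: False
    show ?thesis
    proof (cases "y < v")
      case True
      have "\<not> ereal s + \<sigma>' < ereal s" using nn by (cases \<sigma>') auto
      then show ?thesis using F True
        by (simp add: Let_def up_fun_def jump_step_def exit_times(1,2) flip: s_def k_def y_def \<sigma>'_def)
    next
      case False
      have "up_fun R x v i \<omega> = exp (- w * s) * up_fun R y v k (stl \<omega>)"
      proof (cases \<sigma>')
        case (real r)
        then have "0 \<le> r" using nn by simp
        moreover have "ereal s + \<sigma>' < ereal s + \<rho>' \<longleftrightarrow> \<sigma>' < \<rho>'"
          using nn real by (cases \<rho>') auto
        ultimately show ?thesis using real F False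
          by (simp add: Let_def up_fun_def exit_times(1-3) flip: \<sigma>'_def \<rho>'_def)
             (simp add: algebra_simps exp_diff exp_minus exp_add divide_simps)
      qed (use nn F False in \<open>auto simp: Let_def up_fun_def exit_times(1,2) simp flip: \<sigma>'_def \<rho>'_def\<close>)
      with F False show ?thesis
        by (simp add: jump_step_def flip: s_def k_def y_def)
    qed
  qed
qed

private lemma down_fun_step:
  "down_fun G x v i \<omega> = jump_step 0 (\<lambda>_. 0) G x v i (shd \<omega> i) (\<lambda>y u k. down_fun G y u k (stl \<omega>))"
proof -
  define \<sigma>' where "\<sigma>' = up_time (v + a) (level c p y k (stl \<omega>))"
  define \<rho>' where "\<rho>' = down_time v (level c p y k (stl \<omega>))"
  have nn: "0 \<le> \<sigma>'" "0 \<le> \<rho>'" by (simp_all add: \<sigma>'_def \<rho>'_def up_time_nonneg down_time_nonneg)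
  show ?thesis
  proof (cases "c i * (v + a - x) < s")
    case True
    then have "ereal (c i * (v + a - x)) < down_time v (level c p x i \<omega>)"
      using exit_times(8) by (metis less_ereal.simps(1) order_less_le_trans)
    with True show ?thesis
      by (simp add: Let_def down_fun_def jump_step_def exit_times(1) flip: s_def)
  next
    case F: False
    show ?thesis
    proof (cases "y < v")
      case True
      have "ereal s < ereal s + \<sigma>'" using exit_times(6)[OF True] by (cases \<sigma>') (auto simp: \<sigma>'_def)
      moreover have "level c p y k (stl \<omega>) 0 = y" by (rule level_0[OF good_stl[OF g]])
      moreover have "phase c p y k (stl \<omega>) 0 = k"
        using good_shd[OF good_stl[OF g], of k] by (simp add: phase_shift[OF good_stl[OF g]])
      ultimately show ?thesis using F True
        by (simp add: Let_def down_fun_def jump_step_def exit_times(1-4) flip: s_def k_def y_def \<sigma>'_def)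
    next
      case False
      have "down_fun G x v i \<omega> = exp (- w * s) * down_fun G y v k (stl \<omega>)"
      proof (cases \<rho>')
        case (real r)
        then have "0 \<le> r" using nn by simp
        moreover have "ereal s + \<rho>' < ereal s + \<sigma>' \<longleftrightarrow> \<rho>' < \<sigma>'"
          using nn real by (cases \<sigma>') auto
        ultimately show ?thesis using real F False
          by (simp add: Let_def down_fun_def exit_times(1-4) flip: \<sigma>'_def \<rho>'_def)
             (simp add: algebra_simps exp_diff exp_minus exp_add divide_simps)
      qed (use nn F False in \<open>auto simp: Let_def down_fun_def exit_times(1,2) simp flip: \<sigma>'_def \<rho>'_def\<close>)
      with F False show ?thesis
        by (simp add: jump_step_def flip: s_def k_def y_def)
    qed
  qed
qed

lemmas exit_fun_steps = up_fun_step down_fun_step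

end

lemma jump_functional_up:
  assumes R: "\<And>k. \<bar>R k\<bar> \<le> B"
  shows "jump_functional 0 R (\<lambda>_ _. 0) B (up_fun R)"
proof -
  have "0 \<le> B" using R[of undefined] by linarith
  then have "\<bar>up_fun R x v i \<omega>\<bar> \<le> B" for x v i \<omega>
    by (simp add: Let_def up_fun_def discount_bound[OF up_time_nonneg R, simplified])
  then show ?thesis
    unfolding jump_functional_def using exit_fun_steps(1)[OF _ _ refl refl refl] by blast
qed

lemma jump_functional_down:
  assumes G: "\<And>y k. 0 < y \<Longrightarrow> \<bar>G y k\<bar> \<le> B"
  shows "jump_functional 0 (\<lambda>_. 0) G B (down_fun G)"
proof -
  have B: "0 \<le> B" using G[of 1 undefined] by linarith
  have "\<bar>down_fun G x v i \<omega>\<bar> \<le> B" if "good \<omega>" "start_ok x v" for x v i \<omega>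
  proof -
    \<comment> \<open>This includes \<open>\<rho> = \<infinity>\<close>, where
      \<open>real_of_ereal\<close> returns \<open>0\<close> and the level is the starting
      level.\<close>
    have "0 < level c p x i \<omega> (real_of_ereal \<rho>)" if "0 \<le> \<rho>" for \<rho>
      using \<open>good \<omega>\<close> \<open>start_ok x v\<close> that by (intro level_pos c p) (auto simp: start_ok_def real_of_ereal_pos)
    then show ?thesis
      using B by (simp add: Let_def down_fun_def discount_bound[OF down_time_nonneg G, simplified] down_time_nonneg)
  qed
  then show ?thesis
    unfolding jump_functional_def using exit_fun_steps(2)[OF _ _ refl refl refl] by blast
qed

section \<open>The law of the marks\<close>

abbreviation jump_law :: "('m \<Rightarrow> real \<times> 'm) measure" where
  "jump_law \<equiv> PiM UNIV (mark_law lam Q)"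

abbreviation jump_seq :: "('m \<Rightarrow> real \<times> 'm) stream measure" where
  "jump_seq \<equiv> stream_space jump_law"

lemma prob_space_mark_law: "prob_space (mark_law lam Q i)"
proof -
  interpret A: prob_space "density lborel (\<lambda>s. ennreal (exponential_density (lam i) s))"
    by (rule prob_space_exponential_density[OF lam])
  interpret B: prob_space "measure_pmf (embed_pmf (\<lambda>j. Q $ i $ j))"
    by (rule prob_space_measure_pmf)
  interpret P: pair_prob_space "density lborel (\<lambda>s. ennreal (exponential_density (lam i) s))"
    "measure_pmf (embed_pmf (\<lambda>j. Q $ i $ j))" ..
  show ?thesis unfolding mark_law_def by (rule P.prob_space_axioms)
qed

lemma sets_mark_law [measurable_cong]:
  "sets (mark_law lam Q i) = sets (borel \<Otimes>\<^sub>M count_space UNIV)"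
  unfolding mark_law_def by (intro sets_pair_measure_cong) auto

lemma distr_mark_law_fst:
  "distr (mark_law lam Q i) borel fst = density lborel (\<lambda>s. ennreal (exponential_density (lam i) s))"
proof -
  have "distr (mark_law lam Q i) borel fst =
    distr (mark_law lam Q i) (density lborel (\<lambda>s. ennreal (exponential_density (lam i) s))) fst"
    by (intro distr_cong) auto
  then show ?thesis by (simp add: mark_law_def prob_space.distr_pair_fst[OF prob_space_measure_pmf])
qed

lemma AE_mark_law_pos: "AE m in mark_law lam Q i. 0 < fst m"
proof -
  have "AE s in density lborel (\<lambda>s. ennreal (exponential_density (lam i) s)). 0 < s"
    using AE_lborel_singleton[of 0]
    by (subst AE_density) (auto simp: exponential_density_def elim!: eventually_mono)
  then have "AE s in distr (mark_law lam Q i) borel fst. 0 < s" unfolding distr_mark_law_fst .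
  then show ?thesis by (subst (asm) AE_distr_iff) auto
qed

text \<open>Source of the terms in \<open>beta\<close>: the density times the discount is
  \<open>lam i / (w + lam i)\<close> times the exponential density of rate \<open>w + lam i\<close>,
  written as \<open>erlang_density 0\<close>, and the integral up to \<open>u\<close> is a
  distribution function.\<close>

lemma nn_integral_mark_law_discount:
  assumes "0 \<le> u"
  shows "(\<integral>\<^sup>+m. ennreal (if fst m \<le> u then exp (- w * fst m) else 0) \<partial>mark_law lam Q i)
    = ennreal (lam i / (w + lam i) * (1 - exp (- ((w + lam i) * u))))"
proof -
  let ?r = "lam i / (w + lam i)"
  have r: "0 < w + lam i" "0 \<le> ?r" using w lam[of i] by auto
  have "(\<integral>\<^sup>+m. ennreal (if fst m \<le> u then exp (- w * fst m) else 0) \<partial>mark_law lam Q i)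
    = (\<integral>\<^sup>+s. ennreal (if s \<le> u then exp (- w * s) else 0) \<partial>distr (mark_law lam Q i) borel fst)"
    by (subst nn_integral_distr) auto
  also have "\<dots> = (\<integral>\<^sup>+s. ennreal (exponential_density (lam i) s)
      * ennreal (if s \<le> u then exp (- w * s) else 0) \<partial>lborel)"
    unfolding distr_mark_law_fst by (subst nn_integral_density) auto
  also have "\<dots> = (\<integral>\<^sup>+s. ennreal ?r * (ennreal (erlang_density 0 (w + lam i) s) * indicator {..u} s) \<partial>lborel)"
    using r lam[of i] w
    by (intro nn_integral_cong)
       (auto simp: exponential_density_def mult_exp_exp distrib_left mult_ac simp flip: ennreal_mult split: split_indicator)
  also have "\<dots> = ennreal ?r * ennreal (erlang_CDF 0 (w + lam i) u)"
    using r(1) by (subst nn_integral_cmult) (auto simp: nn_integral_erlang_density)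
  also have "erlang_CDF 0 (w + lam i) u = 1 - exp (- ((w + lam i) * u))"
    using assms by (simp add: erlang_CDF_def flip: mult_minus_left)
  also have "ennreal ?r * ennreal (1 - exp (- ((w + lam i) * u))) = ennreal (?r * (1 - exp (- ((w + lam i) * u))))"
    by (rule ennreal_mult'[OF r(2), symmetric])
  finally show ?thesis .
qed

lemma integral_mark_law_discount:
  assumes "0 \<le> u"
  shows "(\<integral>m. (if fst m \<le> u then exp (- w * fst m) else 0) \<partial>mark_law lam Q i)
    = lam i / (w + lam i) * (1 - exp (- ((w + lam i) * u)))"
proof -
  have "0 \<le> (w + lam i) * u" "0 < w + lam i" using w lam[of i] assms by simp_all
  then have "0 \<le> lam i / (w + lam i) * (1 - exp (- ((w + lam i) * u)))"
    using lam[of i] by (intro mult_nonneg_nonneg) auto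
  then show ?thesis
    by (subst integral_eq_nn_integral) (auto simp: nn_integral_mark_law_discount[OF assms])
qed

lemma integrable_mark_law_bounded:
  assumes "f \<in> borel_measurable (mark_law lam Q i)" "AE m in mark_law lam Q i. \<bar>f m\<bar> \<le> (B::real)"
  shows "integrable (mark_law lam Q i) f"
proof -
  interpret prob_space "mark_law lam Q i" by (rule prob_space_mark_law)
  show ?thesis using assms by (intro integrable_const_bound[of f B]) auto
qed

lemma prob_mark_law_gt:
  assumes "0 \<le> u"
  shows "measure (mark_law lam Q i) {m \<in> space (mark_law lam Q i). u < fst m} = exp (- (lam i * u))"
proof -
  interpret prob_space "mark_law lam Q i" by (rule prob_space_mark_law)
  have "distributed (mark_law lam Q i) lborel fst (exponential_density (lam i))"
    unfolding distributed_def using distr_mark_law_fst[of i]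
    by (auto simp: distr_cong[OF refl sets_lborel])
  from exponential_distributedD_gt[OF this assms lam] show ?thesis by (simp add: mult.commute)
qed

sublocale J: prob_space jump_law
  by (intro prob_space_PiM prob_space_mark_law)

sublocale S: prob_space jump_seq
  by (rule J.prob_space_stream_space)

lemma distr_jump_component: "distr jump_law (mark_law lam Q i) (\<lambda>f. f i) = mark_law lam Q i"
  by (rule distr_PiM_component[OF prob_space_mark_law]) simp

lemma AE_jump_pos: "AE f in jump_law. \<forall>k. 0 < fst (f k)"
proof -
  have "AE f in jump_law. 0 < fst (f k)" for k
    by (rule AE_PiM_component[OF prob_space_mark_law _ AE_mark_law_pos]) simp
  then show ?thesis by (subst AE_all_countable) auto
qed

lemma measurable_min_hold [measurable]: "min_hold \<in> borel_measurable jump_law"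
  unfolding min_hold_def[abs_def] by (intro borel_measurable_Min) auto

lemma min_hold_pos: "(\<And>k. 0 < fst (f k)) \<Longrightarrow> 0 < min_hold f"
  unfolding min_hold_def by (subst Min_gr_iff) auto

lemma measurable_good [measurable]: "Measurable.pred jump_seq good"
proof -
  \<comment> \<open>Thresholds \<open>Z\<close> in \<open>nat\<close> instead of \<open>real\<close>
    leave only countable quantifiers.\<close>
  have eq: "good = (\<lambda>\<omega> :: ('m \<Rightarrow> real \<times> 'm) stream. (\<forall>n k. 0 < fst ((\<omega> !! n) k)) \<and>
      (\<forall>Z::nat. \<exists>N. \<forall>n\<ge>N. real Z \<le> (\<Sum>l<n. min_hold (\<omega> !! l))))"
  proof (intro ext)
    fix \<omega> :: "('m \<Rightarrow> real \<times> 'm) stream"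
    have "filterlim (\<lambda>n. \<Sum>l<n. min_hold (\<omega> !! l)) at_top sequentially \<longleftrightarrow>
      (\<forall>Z::nat. \<exists>N. \<forall>n\<ge>N. real Z \<le> (\<Sum>l<n. min_hold (\<omega> !! l)))"
      unfolding filterlim_at_top eventually_sequentially
      by (meson order_trans real_arch_simple)
    then show "good \<omega> \<longleftrightarrow> (\<forall>n k. 0 < fst ((\<omega> !! n) k)) \<and>
      (\<forall>Z::nat. \<exists>N. \<forall>n\<ge>N. real Z \<le> (\<Sum>l<n. min_hold (\<omega> !! l)))"
      by (simp add: good_def)
  qed
  show ?thesis unfolding eq by measurable
qed

text \<open>The marks are independent and identically distributed, so the Laplace transform of the
  partial sum at \<open>1\<close> factorises.\<close>

lemma nn_integral_exp_min_hold_sum: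
  "(\<integral>\<^sup>+\<omega>. ennreal (exp (- (\<Sum>l<n. min_hold (\<omega> !! l)))) \<partial>jump_seq)
    = (\<integral>\<^sup>+f. ennreal (exp (- min_hold f)) \<partial>jump_law) ^ n"
proof (induction n)
  case 0
  show ?case by (simp add: S.emeasure_space_1)
next
  case (Suc n)
  have "(\<integral>\<^sup>+\<omega>. ennreal (exp (- (\<Sum>l<Suc n. min_hold (\<omega> !! l)))) \<partial>jump_seq)
    = (\<integral>\<^sup>+f. \<integral>\<^sup>+\<omega>. ennreal (exp (- (\<Sum>l<Suc n. min_hold ((f ## \<omega>) !! l)))) \<partial>jump_seq \<partial>jump_law)"
    by (rule J.nn_integral_stream_space) measurable
  also have "\<dots> = (\<integral>\<^sup>+f. \<integral>\<^sup>+\<omega>. ennreal (exp (- min_hold f))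
      * ennreal (exp (- (\<Sum>l<n. min_hold (\<omega> !! l)))) \<partial>jump_seq \<partial>jump_law)"
    by (simp only: min_hold_sum_shift stream.sel minus_add_distrib exp_add ennreal_mult exp_ge_zero)
  also have "\<dots> = (\<integral>\<^sup>+f. ennreal (exp (- min_hold f)) \<partial>jump_law) ^ Suc n"
    by (simp add: nn_integral_cmult nn_integral_multc Suc.IH)
  finally show ?case .
qed

text \<open>
  Along every path the first \<open>n\<close> holding times sum to at least \<open>\<Sum>l<n. min_hold (\<omega> !! l)\<close>, so
  divergence of this series excludes an accumulation of jumps simultaneously for all initial states.
\<close>

lemma AE_good: "AE \<omega> in jump_seq. good \<omega>"
proof -
  define r where "r = (\<integral>f. exp (- min_hold f) \<partial>jump_law)"
  have int: "integrable jump_law (\<lambda>f. exp (- min_hold f))"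
    by (rule J.integrable_const_bound[of _ 1])
       (use AE_jump_pos in \<open>auto elim!: eventually_mono intro: less_imp_le min_hold_pos\<close>)
  \<comment> \<open>Strict, since a minimum of finitely many almost surely positive holding times is
    almost surely positive.\<close>
  have "r < (\<integral>f. 1 \<partial>jump_law)"
    unfolding r_def using AE_jump_pos
    by (intro J.integral_less_AE_space int)
       (auto simp: J.emeasure_space_1 elim!: eventually_mono intro: min_hold_pos)
  then have r1: "r < 1" by (simp add: J.prob_space)
  have r0: "0 \<le> r" unfolding r_def by (rule Bochner_Integration.integral_nonneg) simp
  have r: "(\<integral>\<^sup>+f. ennreal (exp (- min_hold f)) \<partial>jump_law) = ennreal r"
    unfolding r_def by (rule nn_integral_eq_integral[OF int]) simp
  \<comment> \<open>\<open>?I \<omega>\<close> vanishes exactly when the partial sums of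
    \<open>min_hold\<close> are unbounded, and its integral lies below every
    \<open>r ^ n\<close>.\<close>
  let ?I = "\<lambda>\<omega>. INF n. ennreal (exp (- (\<Sum>l<n. min_hold (\<omega> !! l))))"
  have le: "(\<integral>\<^sup>+\<omega>. ?I \<omega> \<partial>jump_seq) \<le> ennreal (r ^ n)" for n
  proof -
    have "(\<integral>\<^sup>+\<omega>. ?I \<omega> \<partial>jump_seq) \<le> (\<integral>\<^sup>+\<omega>. ennreal (exp (- (\<Sum>l<n. min_hold (\<omega> !! l)))) \<partial>jump_seq)"
      by (intro nn_integral_mono INF_lower) simp
    also have "\<dots> = ennreal (r ^ n)" by (simp only: nn_integral_exp_min_hold_sum r ennreal_power[OF r0])
    finally show ?thesis .
  qed
  have "(\<lambda>n. ennreal (r ^ n)) \<longlonglongrightarrow> ennreal 0"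
    using r0 r1 by (intro tendsto_ennrealI LIMSEQ_power_zero) simp
  then have "(\<integral>\<^sup>+\<omega>. ?I \<omega> \<partial>jump_seq) \<le> ennreal 0"
    by (rule LIMSEQ_le_const) (use le in blast)
  then have "(\<integral>\<^sup>+\<omega>. ?I \<omega> \<partial>jump_seq) = 0" by simp
  then have I: "AE \<omega> in jump_seq. ?I \<omega> = 0"
    by (subst (asm) nn_integral_0_iff_AE) auto
  have "AE \<omega> in jump_seq. stream_all (\<lambda>f. \<forall>k. 0 < fst (f k)) \<omega>"
    by (rule J.AE_stream_all[OF _ AE_jump_pos]) measurable
  with I show ?thesis
  proof eventually_elim
    case (elim \<omega>)
    then have pos: "0 < fst ((\<omega> !! n) k)" for n k using sset_range[of \<omega>] by (auto simp: stream.pred_set)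
    have mono: "(\<Sum>l<m. min_hold (\<omega> !! l)) \<le> (\<Sum>l<n. min_hold (\<omega> !! l))" if "m \<le> n" for m n
      using that by (intro sum_mono2) (auto intro: less_imp_le min_hold_pos pos)
    have "filterlim (\<lambda>n. \<Sum>l<n. min_hold (\<omega> !! l)) at_top sequentially"
      unfolding filterlim_at_top eventually_sequentially
    proof
      fix Z :: real
      have "?I \<omega> < ennreal (exp (- Z))" using elim(1) by simp
      then obtain N where "ennreal (exp (- (\<Sum>l<N. min_hold (\<omega> !! l)))) < ennreal (exp (- Z))"
        unfolding INF_less_iff by blast
      then have "Z < (\<Sum>l<N. min_hold (\<omega> !! l))" by (simp add: ennreal_less_iff)
      then show "\<exists>N. \<forall>n\<ge>N. Z \<le> (\<Sum>l<n. min_hold (\<omega> !! l))"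
        using mono by (intro exI[of _ N]) (auto intro: order_trans less_imp_le)
    qed
    with pos show ?case by (simp add: good_def)
  qed
qed

text \<open>Restates the decomposition into first mark and independent tail with a product measure,
  so that Fubini applies to signed integrands.\<close>

lemma jump_seq_eq_distr:
  "jump_seq = distr (jump_law \<Otimes>\<^sub>M jump_seq) jump_seq (\<lambda>(f, \<omega>). f ## \<omega>)" (is "_ = ?D")
proof (rule measure_eqI)
  fix A assume A [measurable]: "A \<in> sets jump_seq"
  have "emeasure jump_seq A = (\<integral>\<^sup>+f. emeasure jump_seq {\<omega> \<in> space jump_seq. f ## \<omega> \<in> A} \<partial>jump_law)"
    by (rule J.emeasure_stream_space[OF A])
  also have "\<dots> = (\<integral>\<^sup>+f. emeasure jump_seq (Pair f -` ((\<lambda>(f, \<omega>). f ## \<omega>) -` A \<inter> space (jump_law \<Otimes>\<^sub>M jump_seq))) \<partial>jump_law)"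
    by (intro nn_integral_cong arg_cong2[where f=emeasure]) (auto simp: space_pair_measure)
  also have "\<dots> = emeasure (jump_law \<Otimes>\<^sub>M jump_seq) ((\<lambda>(f, \<omega>). f ## \<omega>) -` A \<inter> space (jump_law \<Otimes>\<^sub>M jump_seq))"
    by (rule S.emeasure_pair_measure_alt[symmetric]) measurable
  also have "\<dots> = emeasure ?D A" by (rule emeasure_distr[symmetric]) measurable
  finally show "emeasure jump_seq A = emeasure ?D A" .
qed simp

lemma integral_jump_seq_Stream:
  fixes g :: "('m \<Rightarrow> real \<times> 'm) stream \<Rightarrow> real"
  assumes g: "integrable jump_seq g"
  shows "(\<integral>\<omega>. g \<omega> \<partial>jump_seq) = (\<integral>f. \<integral>\<omega>. g (f ## \<omega>) \<partial>jump_seq \<partial>jump_law)"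
proof -
  interpret P: pair_prob_space jump_law jump_seq ..
  have [measurable]: "g \<in> borel_measurable jump_seq" using g by simp
  have "integrable (distr (jump_law \<Otimes>\<^sub>M jump_seq) jump_seq (\<lambda>(f, \<omega>). f ## \<omega>)) g"
    using g by (simp flip: jump_seq_eq_distr)
  then have i: "integrable (jump_law \<Otimes>\<^sub>M jump_seq) (\<lambda>z. g (case z of (f, \<omega>) \<Rightarrow> f ## \<omega>))"
    by (subst (asm) integrable_distr_eq) auto
  have "(\<integral>\<omega>. g \<omega> \<partial>jump_seq) = (\<integral>\<omega>. g \<omega> \<partial>distr (jump_law \<Otimes>\<^sub>M jump_seq) jump_seq (\<lambda>(f, \<omega>). f ## \<omega>))"
    by (simp flip: jump_seq_eq_distr)
  also have "\<dots> = (\<integral>z. g (case z of (f, \<omega>) \<Rightarrow> f ## \<omega>) \<partial>(jump_law \<Otimes>\<^sub>M jump_seq))"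
    by (rule integral_distr) measurable
  also have "\<dots> = (\<integral>f. \<integral>\<omega>. g (f ## \<omega>) \<partial>jump_seq \<partial>jump_law)"
    using P.integral_fst'[OF i] by simp
  finally show ?thesis .
qed

section \<open>Expectations and the one-jump equation\<close>

text \<open>The \<open>n\<close>-th iterate collects what is earned up to the \<open>n\<close>-th
  jump and replaces the rest by \<open>0\<close>. It reads finitely many marks, which makes it
  measurable jointly in state and marks.\<close>

primrec approx :: "real \<Rightarrow> ('m \<Rightarrow> real) \<Rightarrow> (real \<Rightarrow> 'm \<Rightarrow> real) \<Rightarrow> nat
    \<Rightarrow> real \<Rightarrow> real \<Rightarrow> 'm \<Rightarrow> ('m \<Rightarrow> real \<times> 'm) stream \<Rightarrow> real" where
  "approx \<theta> R G 0 = (\<lambda>x v i \<omega>. 0)"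
| "approx \<theta> R G (Suc n) =
     (\<lambda>x v i \<omega>. jump_step \<theta> R G x v i (shd \<omega> i) (\<lambda>y u k. approx \<theta> R G n y u k (stl \<omega>)))"

text \<open>The terms with \<open>R\<close> and \<open>G\<close> cancel. A difference of
  \<open>h\<close> and \<open>h'\<close> counts only if the jump precedes the crossing, and then
  with the discount over the holding time.\<close>

lemma jump_step_diff:
  assumes "\<And>y u. start_ok y u \<Longrightarrow> \<bar>h y u (snd m) - h' y u (snd m)\<bar> \<le> C" "\<bar>\<theta>\<bar> \<le> 1"
    and "start_ok x v" "0 < fst m" "0 \<le> C"
  shows "\<bar>jump_step \<theta> R G x v i m h - jump_step \<theta> R G x v i m h'\<bar>
    \<le> (if c i * (v + a - x) < fst m then 0 else exp (- w * fst m) * C)"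
proof (cases "c i * (v + a - x) < fst m")
  case True
  then show ?thesis by (simp add: jump_step_def)
next
  case False
  define y where "y = p i * (x + fst m / c i)"
  note ok = start_ok_stepE[OF assms(3,4) False, folded y_def]
  show ?thesis
  proof (cases "y < v")
    case True
    have "\<bar>\<theta> * h y y (snd m) - \<theta> * h' y y (snd m)\<bar> = \<bar>\<theta>\<bar> * \<bar>h y y (snd m) - h' y y (snd m)\<bar>"
      by (simp flip: right_diff_distrib add: abs_mult)
    also have "\<dots> \<le> 1 * C" using assms(1)[OF ok(1)[OF True]] assms(2) by (intro mult_mono) auto
    finally have *: "\<bar>\<theta> * h y y (snd m) - \<theta> * h' y y (snd m)\<bar> \<le> C" by simp
    have "jump_step \<theta> R G x v i m h - jump_step \<theta> R G x v i m h'
      = exp (- w * fst m) * (\<theta> * h y y (snd m) - \<theta> * h' y y (snd m))"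
      using False True by (simp add: jump_step_def y_def algebra_simps)
    with False * show ?thesis by (simp add: abs_mult)
  next
    case F: False
    have "jump_step \<theta> R G x v i m h - jump_step \<theta> R G x v i m h'
      = exp (- w * fst m) * (h y v (snd m) - h' y v (snd m))"
      using False F by (simp add: jump_step_def y_def algebra_simps)
    with False assms(1)[OF ok(2)[OF F]] show ?thesis by (simp add: abs_mult)
  qed
qed

text \<open>Each step multiplies the error by a discount over at least the \<open>min_hold\<close>
  of the mark in use. This bound depends on neither state nor phase, so the induction may change
  both.\<close>

lemma approx_error:
  assumes \<Phi>: "jump_functional \<theta> R G B \<Phi>" and \<theta>: "\<bar>\<theta>\<bar> \<le> 1"
  shows "good \<omega> \<Longrightarrow> start_ok x v \<Longrightarrow>
    \<bar>\<Phi> x v i \<omega> - approx \<theta> R G n x v i \<omega>\<bar> \<le> exp (- w * (\<Sum>l<n. min_hold (\<omega> !! l))) * B"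
proof (induction n arbitrary: x v i \<omega>)
  case 0
  then have "\<bar>\<Phi> x v i \<omega>\<bar> \<le> B" using \<Phi> unfolding jump_functional_def by blast
  then show ?case by simp
next
  case (Suc n)
  let ?C = "exp (- w * (\<Sum>l<n. min_hold (stl \<omega> !! l))) * B"
  let ?s = "fst (shd \<omega> i)"
  have "\<bar>\<Phi> x v i \<omega>\<bar> \<le> B" using \<Phi> Suc.prems unfolding jump_functional_def by blast
  then have B: "0 \<le> B" by linarith
  have eq: "\<Phi> x v i \<omega> = jump_step \<theta> R G x v i (shd \<omega> i) (\<lambda>y u k. \<Phi> y u k (stl \<omega>))"
    using \<Phi> Suc.prems unfolding jump_functional_def by blast
  have "\<bar>\<Phi> x v i \<omega> - approx \<theta> R G (Suc n) x v i \<omega>\<bar>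
      \<le> (if c i * (v + a - x) < ?s then 0 else exp (- w * ?s) * ?C)"
    unfolding eq approx.simps
    using Suc.IH[OF good_stl[OF Suc.prems(1)]] \<theta> Suc.prems(2) good_shd[OF Suc.prems(1)] B
    by (intro jump_step_diff) auto
  also have "\<dots> \<le> exp (- w * ?s) * ?C" using B by simp
  also have "\<dots> \<le> exp (- w * min_hold (shd \<omega>)) * ?C"
    using w B min_hold_le[of "shd \<omega>" i] by (intro mult_right_mono) auto
  also have "\<dots> = exp (- w * (\<Sum>l<Suc n. min_hold (\<omega> !! l))) * B"
    unfolding min_hold_sum_shift by (simp add: distrib_left exp_add exp_diff exp_minus divide_simps)
  finally show ?case .
qed

lemma approx_tendsto:
  assumes "jump_functional \<theta> R G B \<Phi>" "\<bar>\<theta>\<bar> \<le> 1" "good \<omega>" "start_ok x v"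
  shows "(\<lambda>n. approx \<theta> R G n x v i \<omega>) \<longlonglongrightarrow> \<Phi> x v i \<omega>"
proof -
  have "filterlim (\<lambda>n. w * (\<Sum>l<n. min_hold (\<omega> !! l))) at_top sequentially"
    using assms(3) w by (intro filterlim_tendsto_pos_mult_at_top[OF tendsto_const]) (auto simp: good_def)
  then have "filterlim (\<lambda>n. - w * (\<Sum>l<n. min_hold (\<omega> !! l))) at_bot sequentially"
    by (simp add: filterlim_uminus_at_top)
  then have "(\<lambda>n. exp (- w * (\<Sum>l<n. min_hold (\<omega> !! l)))) \<longlonglongrightarrow> 0"
    by (rule filterlim_compose[OF exp_at_bot])
  then have "(\<lambda>n. exp (- w * (\<Sum>l<n. min_hold (\<omega> !! l))) * B) \<longlonglongrightarrow> 0"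
    using tendsto_mult_left_zero by blast
  then have "(\<lambda>n. approx \<theta> R G n x v i \<omega> - \<Phi> x v i \<omega>) \<longlonglongrightarrow> 0"
    by (rule Lim_null_comparison[rotated])
       (use approx_error[OF assms(1-4)] in \<open>auto simp: abs_minus_commute\<close>)
  then show ?thesis by (rule Lim_null[THEN iffD2])
qed

text \<open>\<open>x\<close> and \<open>v\<close> depend on \<open>z\<close> because the recursion
  feeds random post-jump states back in. The random next phase takes countably many values, so
  measurability is checked for each fixed phase.\<close>

lemma measurable_jump_step:
  assumes G: "\<And>k. (\<lambda>y. G y k) \<in> borel_measurable borel"
    and [measurable]: "x \<in> borel_measurable N" "v \<in> borel_measurable N"
      "m \<in> N \<rightarrow>\<^sub>M borel \<Otimes>\<^sub>M count_space UNIV"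
    and h: "\<And>y u k. y \<in> borel_measurable N \<Longrightarrow> u \<in> borel_measurable N \<Longrightarrow>
      (\<lambda>z. h z (y z) (u z) k) \<in> borel_measurable N"
  shows "(\<lambda>z. jump_step \<theta> R G (x z) (v z) i (m z) (h z)) \<in> borel_measurable N"
proof -
  let ?y = "\<lambda>z. p i * (x z + fst (m z) / c i)"
  have k: "(\<lambda>z. snd (m z)) \<in> N \<rightarrow>\<^sub>M count_space UNIV" by measurable
  have y: "?y \<in> borel_measurable N" by measurable
  have [measurable]: "(\<lambda>z. G (?y z) (snd (m z))) \<in> borel_measurable N"
    by (rule measurable_compose_countable[OF measurable_compose[OF y G] k])
  have [measurable]: "(\<lambda>z. h z (?y z) (?y z) (snd (m z))) \<in> borel_measurable N"
    by (rule measurable_compose_countable[OF h[OF y y] k])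
  have [measurable]: "(\<lambda>z. h z (?y z) (v z) (snd (m z))) \<in> borel_measurable N"
    by (rule measurable_compose_countable[OF h[OF y assms(3)] k])
  show ?thesis unfolding jump_step_def by measurable
qed

lemma measurable_approx:
  assumes G: "\<And>k. (\<lambda>y. G y k) \<in> borel_measurable borel"
  shows "x \<in> borel_measurable N \<Longrightarrow> v \<in> borel_measurable N \<Longrightarrow> \<xi> \<in> N \<rightarrow>\<^sub>M jump_seq \<Longrightarrow>
    (\<lambda>z. approx \<theta> R G n (x z) (v z) i (\<xi> z)) \<in> borel_measurable N"
proof (induction n arbitrary: x v i \<xi>)
  case (Suc n)
  note [measurable] = Suc.prems
  have "(\<lambda>z. stl (\<xi> z)) \<in> N \<rightarrow>\<^sub>M jump_seq" by measurable
  moreover have "(\<lambda>z. shd (\<xi> z) i) \<in> N \<rightarrow>\<^sub>M mark_law lam Q i" by measurable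
  then have "(\<lambda>z. shd (\<xi> z) i) \<in> N \<rightarrow>\<^sub>M borel \<Otimes>\<^sub>M count_space UNIV"
    by (simp cong: measurable_cong_sets add: measurable_cong_sets[OF refl sets_mark_law])
  ultimately show ?case using Suc.IH
    unfolding approx.simps by (intro measurable_jump_step G) auto
qed simp

text \<open>An integral of the limit rather than of the functional itself: the limit is measurable
  on the uncompleted space jointly with the state, so the integral is Borel in
  \<open>(x, v)\<close>. As \<open>lim\<close> is total, no restriction to convergent streams is
  required here.\<close>

definition value_fun :: "real \<Rightarrow> ('m \<Rightarrow> real) \<Rightarrow> (real \<Rightarrow> 'm \<Rightarrow> real) \<Rightarrow> real \<Rightarrow> real \<Rightarrow> 'm \<Rightarrow> real" where
  "value_fun \<theta> R G x v i = (\<integral>\<omega>. lim (\<lambda>n. approx \<theta> R G n x v i \<omega>) \<partial>jump_seq)"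

lemma measurable_value_fun:
  assumes G: "\<And>k. (\<lambda>y. G y k) \<in> borel_measurable borel"
    and [measurable]: "x \<in> borel_measurable N" "v \<in> borel_measurable N"
  shows "(\<lambda>z. value_fun \<theta> R G (x z) (v z) i) \<in> borel_measurable N"
proof -
  have "(\<lambda>(z, \<omega>). approx \<theta> R G n (x z) (v z) i \<omega>) \<in> borel_measurable (N \<Otimes>\<^sub>M jump_seq)" for n
    unfolding split_beta' by (intro measurable_approx G) measurable
  then have "(\<lambda>(z, \<omega>). lim (\<lambda>n. approx \<theta> R G n (x z) (v z) i \<omega>)) \<in> borel_measurable (N \<Otimes>\<^sub>M jump_seq)"
    unfolding split_beta' by (intro borel_measurable_lim_metric) auto
  then show ?thesis unfolding value_fun_def by (rule S.borel_measurable_lebesgue_integral)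
qed

text \<open>Where \<open>P\<close> fails \<open>g\<close> may be arbitrary, because every subset of
  a null set belongs to the completion.\<close>

lemma measurable_completion_eq_AE:
  fixes f g :: "'a \<Rightarrow> real"
  assumes f [measurable]: "f \<in> borel_measurable M" and eq: "AE \<omega> in M. P \<omega>" "\<And>\<omega>. P \<omega> \<Longrightarrow> g \<omega> = f \<omega>"
    and [measurable]: "Measurable.pred M P"
  shows "g \<in> borel_measurable (completion M)"
proof (rule measurableI)
  fix A :: "real set" assume [measurable]: "A \<in> sets borel"
  have "{\<omega> \<in> space M. P \<omega> \<and> f \<omega> \<in> A} \<in> sets M"
    by measurable
  then have "{\<omega> \<in> space M. P \<omega> \<and> f \<omega> \<in> A} \<in> sets (completion M)"
    by (rule sets_completionI_sets)
  moreover have "Measurable.pred (completion M) (\<lambda>\<omega>. \<not> P \<omega> \<and> g \<omega> \<in> A)"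
    using eq(1) by (intro sets_completion_AE) auto
  then have "{\<omega> \<in> space M. \<not> P \<omega> \<and> g \<omega> \<in> A} \<in> sets (completion M)"
    by (simp add: pred_def)
  moreover have "g -` A \<inter> space (completion M) =
    {\<omega> \<in> space M. P \<omega> \<and> f \<omega> \<in> A} \<union> {\<omega> \<in> space M. \<not> P \<omega> \<and> g \<omega> \<in> A}"
    using eq(2) by auto
  ultimately show "g -` A \<inter> space (completion M) \<in> sets (completion M)"
    by (simp only: sets.Un)
qed simp

section \<open>Expectations of functionals that satisfy the recursion\<close>

context
  fixes \<theta> R G B \<Phi>
  assumes \<Phi>: "jump_functional \<theta> R G B \<Phi>" and \<theta>: "\<bar>\<theta>\<bar> \<le> 1"
    and G: "\<And>k. (\<lambda>y. G y k) \<in> borel_measurable borel"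
begin

private abbreviation "L x v i \<omega> \<equiv> lim (\<lambda>n. approx \<theta> R G n x v i \<omega>)"

private lemma L_eq: "good \<omega> \<Longrightarrow> start_ok x v \<Longrightarrow> L x v i \<omega> = \<Phi> x v i \<omega>"
  by (intro limI approx_tendsto[OF \<Phi> \<theta>])

private lemma bound: "good \<omega> \<Longrightarrow> start_ok x v \<Longrightarrow> \<bar>\<Phi> x v i \<omega>\<bar> \<le> B"
  using \<Phi> unfolding jump_functional_def by blast

private lemma L_meas [measurable]: "L x v i \<in> borel_measurable jump_seq"
  by (intro borel_measurable_lim_metric measurable_approx G) auto

private lemma L_int: "start_ok x v \<Longrightarrow> integrable jump_seq (L x v i)"
  by (rule S.integrable_const_bound[of _ B])
     (use AE_good in \<open>auto elim!: eventually_mono simp: L_eq bound\<close>)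

lemma measurable_jump_functional:
  assumes "start_ok x v" shows "\<Phi> x v i \<in> borel_measurable (mark_space lam Q)"
  unfolding mark_space_def
  by (rule measurable_completion_eq_AE[OF L_meas[of x v i] AE_good _ measurable_good])
     (simp add: L_eq assms)

private lemma AE_L_eq:
  assumes "start_ok x v" shows "AE \<omega> in mark_space lam Q. L x v i \<omega> = \<Phi> x v i \<omega>"
  unfolding mark_space_def
  by (rule AE_completion, rule eventually_mono[OF AE_good]) (rule L_eq[OF _ assms])

private lemma L_meas' [measurable]: "L x v i \<in> borel_measurable (mark_space lam Q)"
  unfolding mark_space_def by (intro measurable_completion) measurable

lemma integrable_jump_functional:
  assumes "start_ok x v" shows "integrable (mark_space lam Q) (\<Phi> x v i)"
proof -
  have "integrable (mark_space lam Q) (L x v i)"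
    unfolding mark_space_def using L_int[OF assms] by (simp add: integrable_completion)
  then show ?thesis
    by (rule integrable_cong_AE_imp[OF _ measurable_jump_functional[OF assms]])
       (use AE_L_eq[OF assms] in \<open>auto elim!: eventually_mono\<close>)
qed

lemma integral_jump_functional:
  assumes "start_ok x v" shows "(\<integral>\<omega>. \<Phi> x v i \<omega> \<partial>mark_space lam Q) = value_fun \<theta> R G x v i"
proof -
  have "(\<integral>\<omega>. \<Phi> x v i \<omega> \<partial>mark_space lam Q) = (\<integral>\<omega>. L x v i \<omega> \<partial>mark_space lam Q)"
    by (intro integral_cong_AE measurable_jump_functional[OF assms] L_meas'
        eventually_mono[OF AE_L_eq[OF assms, of i]]) simp
  also have "\<dots> = value_fun \<theta> R G x v i"
    unfolding mark_space_def value_fun_def by (rule integral_completion) measurable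
  finally show ?thesis .
qed

lemma value_fun_bounds:
  assumes "start_ok x v" and "\<And>\<omega>. good \<omega> \<Longrightarrow> l \<le> \<Phi> x v i \<omega>" "\<And>\<omega>. good \<omega> \<Longrightarrow> \<Phi> x v i \<omega> \<le> u"
  shows "l \<le> value_fun \<theta> R G x v i" "value_fun \<theta> R G x v i \<le> u"
  unfolding value_fun_def
  by (rule S.integral_ge_const S.integral_le_const, rule L_int[OF assms(1)],
      use AE_good in \<open>auto simp: L_eq assms elim!: eventually_mono\<close>)+

lemma abs_value_fun_le:
  assumes "start_ok x v" shows "\<bar>value_fun \<theta> R G x v i\<bar> \<le> B"
  using value_fun_bounds[OF assms, of "- B" i B] bound[OF _ assms] by (auto simp: abs_le_iff minus_le_iff)

text \<open>Conditioning on the first mark: by \<open>good_iff\<close>, a mark with positive holding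
  times followed by almost any stream is good, so the pathwise recursion applies;
  \<open>jump_step\<close> is affine in \<open>h\<close>, so the expectation over the tail moves
  inside.\<close>

lemma value_fun_step:
  assumes xv: "start_ok x v"
  shows "value_fun \<theta> R G x v i
    = (\<integral>m. jump_step \<theta> R G x v i m (value_fun \<theta> R G) \<partial>mark_law lam Q i)"
proof -
  let ?J = "\<lambda>m. jump_step \<theta> R G x v i m (value_fun \<theta> R G)"
  have inner: "(\<integral>\<omega>. L x v i (f ## \<omega>) \<partial>jump_seq) = ?J (f i)" if f: "\<forall>k. 0 < fst (f k)" for f
  proof -
    have s: "0 < fst (f i)" using f by blast
    have "(\<integral>\<omega>. L x v i (f ## \<omega>) \<partial>jump_seq)
      = (\<integral>\<omega>. jump_step \<theta> R G x v i (f i) (\<lambda>y u k. L y u k \<omega>) \<partial>jump_seq)"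
    proof (rule integral_cong_AE)
      show "AE \<omega> in jump_seq. L x v i (f ## \<omega>) = jump_step \<theta> R G x v i (f i) (\<lambda>y u k. L y u k \<omega>)"
        using AE_good
      proof eventually_elim
        case (elim \<omega>)
        then have g: "good (f ## \<omega>)" using f by (subst good_iff) simp
        then have "L x v i (f ## \<omega>) = \<Phi> x v i (f ## \<omega>)" by (rule L_eq[OF _ xv])
        also have "\<dots> = jump_step \<theta> R G x v i (f i) (\<lambda>y u k. \<Phi> y u k \<omega>)"
          using \<Phi> g xv unfolding jump_functional_def by (metis stream.sel)
        also have "\<dots> = jump_step \<theta> R G x v i (f i) (\<lambda>y u k. L y u k \<omega>)"
          by (intro jump_step_cong xv s L_eq[OF elim, symmetric]) auto
        finally show ?case .
      qed
      have "f \<in> space jump_law"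
        using sets_eq_imp_space_eq[OF sets_mark_law] by (auto simp: space_PiM space_pair_measure)
      then show "(\<lambda>\<omega>. L x v i (f ## \<omega>)) \<in> borel_measurable jump_seq" by measurable
      show "(\<lambda>\<omega>. jump_step \<theta> R G x v i (f i) (\<lambda>y u k. L y u k \<omega>)) \<in> borel_measurable jump_seq"
        by (rule measurable_jump_step[OF G])
           (auto intro!: borel_measurable_lim_metric measurable_approx G simp: space_pair_measure)
    qed
    also have "\<dots> = ?J (f i)"
    proof (cases "c i * (v + a - x) < fst (f i)")
      case True
      then show ?thesis by (simp add: jump_step_def S.prob_space)
    next
      case False
      note ok = start_ok_stepE[OF xv s False]
      show ?thesis
        using False L_int[OF ok(1)] L_int[OF ok(2)]
        by (simp add: jump_step_def value_fun_def S.prob_space)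
    qed
    finally show ?thesis .
  qed
  have meas: "?J \<in> borel_measurable (mark_law lam Q i)"
    by (rule measurable_jump_step[OF G])
       (auto intro!: measurable_value_fun G measurable_ident_sets[OF sets_mark_law])
  have "value_fun \<theta> R G x v i = (\<integral>f. \<integral>\<omega>. L x v i (f ## \<omega>) \<partial>jump_seq \<partial>jump_law)"
    unfolding value_fun_def by (rule integral_jump_seq_Stream[OF L_int[OF xv]])
  also have "\<dots> = (\<integral>f. ?J (f i) \<partial>jump_law)"
  proof (rule integral_cong_AE)
    show "AE f in jump_law. (\<integral>\<omega>. L x v i (f ## \<omega>) \<partial>jump_seq) = ?J (f i)"
      using AE_jump_pos by eventually_elim (rule inner)
    show "(\<lambda>f. ?J (f i)) \<in> borel_measurable jump_law"
      by (rule measurable_compose[OF _ meas]) (auto intro: measurable_component_singleton)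
    show "(\<lambda>f. \<integral>\<omega>. L x v i (f ## \<omega>) \<partial>jump_seq) \<in> borel_measurable jump_law"
      by measurable
  qed
  \<comment> \<open>Of the first mark only the pair offered to the current phase \<open>i\<close> is
    used.\<close>
  also have "\<dots> = (\<integral>m. ?J m \<partial>distr jump_law (mark_law lam Q i) (\<lambda>f. f i))"
    by (rule integral_distr[symmetric]) (auto simp: meas)
  finally show ?thesis by (simp only: distr_jump_component)
qed

end

section \<open>The contraction constant\<close>

lemma first_jump_le_beta:
  assumes "start_ok x v"
  shows "(\<integral>m. (if c i * (v + a - x) < fst m then 0 else exp (- w * fst m)) \<partial>mark_law lam Q i)
    \<le> beta c lam w a"
proof -
  let ?u = "c i * (v + a - x)"
  have u: "0 \<le> ?u" "?u \<le> c i * a" using assms c[of i] by (auto simp: start_ok_def)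
  have "(\<integral>m. (if ?u < fst m then 0 else exp (- w * fst m)) \<partial>mark_law lam Q i)
    = (\<integral>m. (if fst m \<le> ?u then exp (- w * fst m) else 0) \<partial>mark_law lam Q i)"
    by (rule Bochner_Integration.integral_cong) auto
  also have "\<dots> = lam i / (w + lam i) * (1 - exp (- ((w + lam i) * ?u)))"
    by (rule integral_mark_law_discount[OF u(1)])
  also have "\<dots> \<le> lam i / (w + lam i) * (1 - exp (- ((w + lam i) * (c i * a))))"
    using u(2) w lam[of i] by (intro mult_left_mono) (auto simp: mult_left_mono)
  also have "\<dots> = lam i / (w + lam i) * (1 - exp (- (c i * (lam i + w)) * a))"
    by (simp add: algebra_simps)
  also have "\<dots> \<le> beta c lam w a" unfolding beta_def by (rule Max_ge) auto
  finally show ?thesis .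
qed

lemma beta_nonneg: "0 \<le> beta c lam w a"
proof -
  have "0 \<le> (\<integral>m. (if c i * (1 + a - 1) < fst m then 0 else exp (- w * fst m)) \<partial>mark_law lam Q i)" for i
    by (rule Bochner_Integration.integral_nonneg) simp
  with first_jump_le_beta[OF start_ok_diag[of 1]] show ?thesis by (meson order_trans zero_less_one)
qed

lemma beta_less_1: "beta c lam w a < 1"
proof -
  have "lam i / (w + lam i) * (1 - exp (- (c i * (lam i + w)) * a)) < 1 * 1" for i
    using w lam[of i] by (intro mult_strict_mono') (auto simp: c a lam add_pos_pos less_imp_le mult_nonneg_nonneg)
  then show ?thesis unfolding beta_def by (subst Max_less_iff) auto
qed

lemma integral_first_jump_bound:
  assumes "start_ok x v" "0 \<le> C" and int: "integrable (mark_law lam Q i) g"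
    and g: "AE m in mark_law lam Q i. \<bar>g m\<bar>
      \<le> (if c i * (v + a - x) < fst m then 0 else exp (- w * fst m)) * C" (is "AE m in _. _ \<le> ?b m")
  shows "\<bar>\<integral>m. g m \<partial>mark_law lam Q i\<bar> \<le> beta c lam w a * C"
proof -
  have b: "integrable (mark_law lam Q i) ?b"
  proof (rule integrable_mark_law_bounded[of _ _ C])
    have "fst \<in> borel_measurable (mark_law lam Q i)" by measurable
    then show "?b \<in> borel_measurable (mark_law lam Q i)"
      by (rule measurable_compose) measurable
    show "AE m in mark_law lam Q i. \<bar>?b m\<bar> \<le> C"
      using AE_mark_law_pos by eventually_elim (use w assms(2) in \<open>auto simp: abs_mult mult_left_le_one_le\<close>)
  qed
  have "\<bar>\<integral>m. g m \<partial>mark_law lam Q i\<bar> \<le> (\<integral>m. \<bar>g m\<bar> \<partial>mark_law lam Q i)" by (rule integral_abs_bound)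
  also have "\<dots> \<le> (\<integral>m. ?b m \<partial>mark_law lam Q i)"
    by (rule integral_mono_AE[OF _ b g]) (use int in simp)
  also have "\<dots> \<le> beta c lam w a * C"
    using first_jump_le_beta[OF assms(1), of i] assms(2) by (simp add: mult_right_mono)
  finally show ?thesis .
qed

text \<open>Contraction for a single jump, at all admissible states. It compares two candidate
  values that solve the same one-jump equation.\<close>

lemma integral_jump_step_diff:
  assumes "start_ok x v" "\<bar>\<theta>\<bar> \<le> 1" "0 \<le> C"
    and le: "\<And>y u k. start_ok y u \<Longrightarrow> \<bar>h y u k - h' y u k\<bar> \<le> C"
    and int: "integrable (mark_law lam Q i) (\<lambda>m. jump_step \<theta> R G x v i m h)"
      "integrable (mark_law lam Q i) (\<lambda>m. jump_step \<theta> R G x v i m h')"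
  shows "\<bar>(\<integral>m. jump_step \<theta> R G x v i m h \<partial>mark_law lam Q i)
    - (\<integral>m. jump_step \<theta> R G x v i m h' \<partial>mark_law lam Q i)\<bar> \<le> beta c lam w a * C"
  unfolding Bochner_Integration.integral_diff[OF int, symmetric]
proof (rule integral_first_jump_bound[OF assms(1,3) Bochner_Integration.integrable_diff[OF int]])
  show "AE m in mark_law lam Q i. \<bar>jump_step \<theta> R G x v i m h - jump_step \<theta> R G x v i m h'\<bar>
      \<le> (if c i * (v + a - x) < fst m then 0 else exp (- w * fst m)) * C"
    using AE_mark_law_pos
  proof eventually_elim
    case (elim m)
    from jump_step_diff[of h m h' C \<theta> x v R G i, OF le assms(2,1) elim assms(3)]
    show ?case by (simp split: if_splits)
  qed
qed

end

section \<open>Matrix-valued functions and the fixed point\<close>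

lemma mat_norm_le_iff: "mat_norm M \<le> C \<longleftrightarrow> (\<forall>i. (\<Sum>j\<in>UNIV. \<bar>M $ i $ j\<bar>) \<le> C)"
  unfolding mat_norm_def by (subst Max_le_iff) auto

lemma row_sum_le_mat_norm: "(\<Sum>j\<in>UNIV. \<bar>M $ i $ j\<bar>) \<le> mat_norm M"
  using mat_norm_le_iff[of M "mat_norm M"] by simp

lemma entry_le_mat_norm: "\<bar>M $ i $ j\<bar> \<le> mat_norm M"
  by (rule order_trans[OF member_le_sum row_sum_le_mat_norm]) auto

lemma mat_norm_nonneg: "0 \<le> mat_norm M"
  by (rule order_trans[OF abs_ge_zero entry_le_mat_norm])

text \<open>The witnesses \<open>f i j\<close> live on all of \<open>real\<close>, as
  \<open>value_fun\<close> does, while \<open>F\<close> has to agree with them on positive levels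
  only.\<close>

lemma bounded_BorelI:
  fixes F :: "real \<Rightarrow> real ^ 'm::finite ^ 'm"
  assumes f: "\<And>i j. f i j \<in> borel_measurable borel"
    and eq: "\<And>v i j. 0 < v \<Longrightarrow> F v $ i $ j = f i j v"
    and B: "\<And>v i j. 0 < v \<Longrightarrow> \<bar>F v $ i $ j\<bar> \<le> B"
  shows "bounded_Borel F"
  unfolding bounded_Borel_def
proof
  have "(\<lambda>v. \<chi> i j. f i j v) \<in> borel_measurable borel"
  proof (rule borel_measurable_euclidean_space[THEN iffD2], rule ballI)
    fix b :: "real ^ 'm ^ 'm" assume "b \<in> Basis"
    then obtain i j where b: "b = axis i (axis j 1)" unfolding Basis_vec_def by auto
    have "(\<lambda>v. (\<chi> i j. f i j v) \<bullet> b) = f i j" by (simp add: b inner_axis fun_eq_iff)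
    with f show "(\<lambda>v. (\<chi> i j. f i j v) \<bullet> b) \<in> borel_measurable borel" by (simp only:)
  qed
  then have "(\<lambda>v. \<chi> i j. f i j v) \<in> borel_measurable (restrict_space borel {0<..})"
    by (rule measurable_restrict_space1)
  then show "F \<in> borel_measurable (restrict_space borel {0<..})"
    by (rule measurable_cong[THEN iffD1, rotated]) (auto simp: vec_eq_iff eq)
  show "bounded (F ` {0<..})"
    unfolding bounded_iff
  proof (intro exI ballI)
    fix M assume "M \<in> F ` {0<..}"
    then obtain v where v: "0 < v" "M = F v" by auto
    have "norm M \<le> (\<Sum>i\<in>UNIV. norm (M $ i))"
      unfolding norm_vec_def by (rule L2_set_le_sum) simp
    also have "\<dots> \<le> (\<Sum>i\<in>UNIV. \<Sum>j\<in>UNIV. \<bar>M $ i $ j\<bar>)"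
      by (intro sum_mono norm_le_l1_cart)
    also have "\<dots> \<le> (\<Sum>i\<in>(UNIV::'m set). \<Sum>j\<in>(UNIV::'m set). B)"
      unfolding v(2) by (intro sum_mono B v(1))
    finally show "norm M \<le> (\<Sum>i\<in>(UNIV::'m set). \<Sum>j\<in>(UNIV::'m set). B)" .
  qed
qed

lemma bounded_Borel_entries:
  fixes F :: "real \<Rightarrow> real ^ 'm::finite ^ 'm"
  assumes "bounded_Borel F"
  obtains B where "\<And>v i j. 0 < v \<Longrightarrow> \<bar>F v $ i $ j\<bar> \<le> B"
proof -
  obtain B where B: "\<And>v. 0 < v \<Longrightarrow> norm (F v) \<le> B"
    using assms unfolding bounded_Borel_def bounded_iff by auto
  have "\<bar>F v $ i $ j\<bar> \<le> B" if "0 < v" for v i j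
  proof -
    have "\<bar>F v $ i $ j\<bar> \<le> norm (F v $ i)" by (rule component_le_norm_cart)
    also have "\<dots> \<le> norm (F v)" by (rule Finite_Cartesian_Product.norm_nth_le)
    finally show ?thesis using B[OF that] by linarith
  qed
  with that show ?thesis by blast
qed

text \<open>Extension by \<open>0\<close> gives a Borel function on the whole line, the form in
  which the measurability lemmas take \<open>G\<close>.\<close>

definition pos_entry :: "(real \<Rightarrow> real ^ 'm ^ 'm) \<Rightarrow> 'm \<Rightarrow> real \<Rightarrow> 'm \<Rightarrow> real" where
  "pos_entry F j y k = (if 0 < y then F y $ k $ j else 0)"

lemma measurable_pos_entry:
  fixes F :: "real \<Rightarrow> real ^ 'm::finite ^ 'm"
  assumes "bounded_Borel F" shows "(\<lambda>y. pos_entry F j y k) \<in> borel_measurable borel"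
proof -
  have "(\<lambda>M::real^'m^'m. M $ k $ j) \<in> borel_measurable borel"
    by (intro borel_measurable_continuous_onI continuous_intros)
  with assms have "(\<lambda>y. F y $ k $ j) \<in> borel_measurable (restrict_space borel {0<..})"
    unfolding bounded_Borel_def by (auto intro: measurable_compose)
  then have "(\<lambda>y. indicator {0<..} y *\<^sub>R F y $ k $ j) \<in> borel_measurable borel"
    by (subst (asm) borel_measurable_restrict_space_iff) auto
  also have "(\<lambda>y. indicator {0<..} y *\<^sub>R F y $ k $ j) = (\<lambda>y. pos_entry F j y k)"
    by (auto simp: pos_entry_def indicator_def)
  finally show ?thesis .
qed

lemma bounded_Borel_diff:
  assumes F: "bounded_Borel F" and F': "bounded_Borel F'"
  shows "bounded_Borel (\<lambda>v. F v - F' v)"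
proof -
  obtain B where B: "\<And>v i j. 0 < v \<Longrightarrow> \<bar>F v $ i $ j\<bar> \<le> B" using bounded_Borel_entries[OF F] by blast
  obtain B' where B': "\<And>v i j. 0 < v \<Longrightarrow> \<bar>F' v $ i $ j\<bar> \<le> B'" using bounded_Borel_entries[OF F'] by blast
  show ?thesis
  proof (rule bounded_BorelI)
    fix i j
    show "(\<lambda>v. pos_entry F j v i - pos_entry F' j v i) \<in> borel_measurable borel"
      by (intro borel_measurable_diff measurable_pos_entry F F')
    fix v :: real assume v: "0 < v"
    then show "(F v - F' v) $ i $ j = pos_entry F j v i - pos_entry F' j v i"
      by (simp add: pos_entry_def)
    show "\<bar>(F v - F' v) $ i $ j\<bar> \<le> B + B'"
      using B[OF v, of i j] B'[OF v, of i j] by simp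
  qed
qed

text \<open>Closes the arguments in which an induction gains one factor \<open>q\<close> per use of
  an equation, starting from some crude bound \<open>C\<close>.\<close>

lemma nonpos_if_le_geometric:
  fixes d C q :: real
  assumes "\<And>n. d \<le> C * q ^ n" "0 \<le> q" "q < 1"
  shows "d \<le> 0"
proof -
  have "(\<lambda>n. C * q ^ n) \<longlonglongrightarrow> C * 0"
    using assms by (intro tendsto_mult tendsto_const LIMSEQ_power_zero) simp
  then have "d \<le> C * 0" by (rule LIMSEQ_le_const) (use assms(1) in blast)
  then show ?thesis by simp
qed

context jump_model
begin

lemma jump_functional_cong:
  assumes "jump_functional \<theta> R G B \<Phi>" "\<And>y k. 0 < y \<Longrightarrow> G y k = G' y k"
  shows "jump_functional \<theta> R G' B \<Phi>"
  unfolding jump_functional_def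
proof (intro allI impI conjI)
  fix x v i and \<omega> :: "('m \<Rightarrow> real \<times> 'm) stream" assume *: "good \<omega>" "start_ok x v"
  then show "\<bar>\<Phi> x v i \<omega>\<bar> \<le> B" using assms(1) unfolding jump_functional_def by blast
  have "\<Phi> x v i \<omega> = jump_step \<theta> R G x v i (shd \<omega> i) (\<lambda>y u k. \<Phi> y u k (stl \<omega>))"
    using assms(1) * unfolding jump_functional_def by blast
  also have "\<dots> = jump_step \<theta> R G' x v i (shd \<omega> i) (\<lambda>y u k. \<Phi> y u k (stl \<omega>))"
    by (intro jump_step_cong * good_shd assms(2) refl)
  finally show "\<Phi> x v i \<omega> = jump_step \<theta> R G' x v i (shd \<omega> i) (\<lambda>y u k. \<Phi> y u k (stl \<omega>))" .
qed

text \<open>\<open>jump_step\<close> is additive jointly in \<open>R\<close>, \<open>G\<close> and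
  \<open>h\<close>. Up and down rewards therefore merge into one functional, which represents
  \<open>Z_plus\<close> plus \<open>V_op\<close>.\<close>

lemma jump_functional_add:
  assumes 1: "jump_functional \<theta> R G B \<Phi>" and 2: "jump_functional \<theta> R' G' B' \<Phi>'"
  shows "jump_functional \<theta> (\<lambda>k. R k + R' k) (\<lambda>y k. G y k + G' y k) (B + B')
    (\<lambda>x v i \<omega>. \<Phi> x v i \<omega> + \<Phi>' x v i \<omega>)"
  unfolding jump_functional_def
proof (intro allI impI conjI)
  fix x v i and \<omega> :: "('m \<Rightarrow> real \<times> 'm) stream" assume *: "good \<omega>" "start_ok x v"
  have "\<bar>\<Phi> x v i \<omega>\<bar> \<le> B" "\<bar>\<Phi>' x v i \<omega>\<bar> \<le> B'"
    using 1 2 * unfolding jump_functional_def by blast+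
  then show "\<bar>\<Phi> x v i \<omega> + \<Phi>' x v i \<omega>\<bar> \<le> B + B'" by linarith
  have "\<Phi> x v i \<omega> = jump_step \<theta> R G x v i (shd \<omega> i) (\<lambda>y u k. \<Phi> y u k (stl \<omega>))"
    "\<Phi>' x v i \<omega> = jump_step \<theta> R' G' x v i (shd \<omega> i) (\<lambda>y u k. \<Phi>' y u k (stl \<omega>))"
    using 1 2 * unfolding jump_functional_def by blast+
  then show "\<Phi> x v i \<omega> + \<Phi>' x v i \<omega> = jump_step \<theta> (\<lambda>k. R k + R' k) (\<lambda>y k. G y k + G' y k) x v i
      (shd \<omega> i) (\<lambda>y u k. \<Phi> y u k (stl \<omega>) + \<Phi>' y u k (stl \<omega>))"
    by (simp add: jump_step_def algebra_simps)
qed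

text \<open>The factor \<open>2\<close> stems from the passage branch, where the reward
  \<open>G\<close> and the restart may both contribute.\<close>

lemma jump_step_bound:
  assumes "start_ok x v" "0 < fst m" "\<bar>\<theta>\<bar> \<le> 1"
    and R: "\<And>k. \<bar>R k\<bar> \<le> B" and G: "\<And>y k. 0 < y \<Longrightarrow> \<bar>G y k\<bar> \<le> B"
    and h: "\<And>y u k. start_ok y u \<Longrightarrow> \<bar>h y u k\<bar> \<le> B"
  shows "\<bar>jump_step \<theta> R G x v i m h\<bar> \<le> 2 * B"
proof -
  have B: "0 \<le> B" using R[of undefined] by linarith
  have disc: "\<bar>exp (- w * t) * r\<bar> \<le> 2 * B" if "0 \<le> t" "\<bar>r\<bar> \<le> 2 * B" for t r
    using discount_bound[of "ereal t" r "2 * B"] that by simp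
  show ?thesis
  proof (cases "c i * (v + a - x) < fst m")
    case True
    moreover have "0 \<le> c i * (v + a - x)" using c[of i] assms(1) by (simp add: start_ok_def)
    ultimately show ?thesis using B R[of i] disc by (simp add: jump_step_def)
  next
    case False
    define y where "y = p i * (x + fst m / c i)"
    note ok = start_ok_stepE[OF assms(1,2) False, folded y_def]
    have y: "0 < y" unfolding y_def by (rule after_jump_pos[OF assms(1,2)])
    show ?thesis
    proof (cases "y < v")
      case True
      have "\<bar>\<theta> * h y y (snd m)\<bar> \<le> 1 * B"
        unfolding abs_mult using assms(3) h[OF ok(1)[OF True]] by (intro mult_mono) auto
      with G[OF y, of "snd m"] have "\<bar>G y (snd m) + \<theta> * h y y (snd m)\<bar> \<le> 2 * B" by linarith
      with False True assms(2) show ?thesis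
        using disc by (simp add: jump_step_def flip: y_def)
    next
      case F: False
      with h[OF ok(2)[OF F], of "snd m"] B False assms(2) show ?thesis
        using disc by (simp add: jump_step_def flip: y_def)
    qed
  qed
qed

lemma integrable_jump_step:
  assumes "start_ok x v" "\<bar>\<theta>\<bar> \<le> 1"
    and "\<And>k. \<bar>R k\<bar> \<le> B" "\<And>y k. 0 < y \<Longrightarrow> \<bar>G y k\<bar> \<le> B" "\<And>y u k. start_ok y u \<Longrightarrow> \<bar>h y u k\<bar> \<le> B"
    and G: "\<And>k. (\<lambda>y. G y k) \<in> borel_measurable borel"
    and h: "\<And>f g k. f \<in> borel_measurable (mark_law lam Q i) \<Longrightarrow> g \<in> borel_measurable (mark_law lam Q i) \<Longrightarrow>
      (\<lambda>m. h (f m) (g m) k) \<in> borel_measurable (mark_law lam Q i)"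
  shows "integrable (mark_law lam Q i) (\<lambda>m. jump_step \<theta> R G x v i m h)"
proof (rule integrable_mark_law_bounded)
  show "(\<lambda>m. jump_step \<theta> R G x v i m h) \<in> borel_measurable (mark_law lam Q i)"
    by (rule measurable_jump_step[OF G]) (auto intro: h measurable_ident_sets[OF sets_mark_law])
  show "AE m in mark_law lam Q i. \<bar>jump_step \<theta> R G x v i m h\<bar> \<le> 2 * B"
    using AE_mark_law_pos by eventually_elim (intro jump_step_bound assms)
qed

section \<open>Matrix entries as expectations of functionals\<close>

definition unit_reward :: "'m \<Rightarrow> 'm \<Rightarrow> real" where
  "unit_reward j k = (if k = j then 1 else 0)"

abbreviation H :: "real \<Rightarrow> real ^ 'm ^ 'm" where
  "H \<equiv> H_mat c lam p Q w a"

lemma H_entry_integral: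
  "H v $ i $ j = (\<integral>\<omega>. drawup_fun (unit_reward j) v v i \<omega> \<partial>mark_space lam Q)"
  unfolding H_mat_def vec_lambda_beta
  by (rule Bochner_Integration.integral_cong) (auto simp: drawup_fun_def unit_reward_def Let_def)

lemma Z_plus_entry_integral:
  "Z_plus c lam p Q w a v $ i $ j = (\<integral>\<omega>. up_fun (unit_reward j) v v i \<omega> \<partial>mark_space lam Q)"
  unfolding Z_plus_def vec_lambda_beta
  by (rule Bochner_Integration.integral_cong) (auto simp: up_fun_def unit_reward_def Let_def)

lemma V_op_entry_integral:
  "V_op c lam p Q w a F v $ i $ j = (\<integral>\<omega>. down_fun (\<lambda>y k. F y $ k $ j) v v i \<omega> \<partial>mark_space lam Q)"
  unfolding V_op_def vec_lambda_beta
  by (rule Bochner_Integration.integral_cong) (auto simp: down_fun_def Let_def)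

lemma unit_reward_bound: "\<bar>unit_reward j k\<bar> \<le> 1"
  by (simp add: unit_reward_def)

lemma H_entry:
  assumes "0 < v" shows "H v $ i $ j = value_fun 1 (unit_reward j) (\<lambda>_ _. 0) v v i"
  unfolding H_entry_integral
  by (rule integral_jump_functional[OF jump_functional_drawup[OF unit_reward_bound]])
     (auto simp: start_ok_diag assms)

lemma Z_plus_entry:
  assumes "0 < v" shows "Z_plus c lam p Q w a v $ i $ j = value_fun 0 (unit_reward j) (\<lambda>_ _. 0) v v i"
  unfolding Z_plus_entry_integral
  by (rule integral_jump_functional[OF jump_functional_up[OF unit_reward_bound]])
     (auto simp: start_ok_diag assms)

lemma jump_functional_down_entry:
  assumes "\<And>y i j. 0 < y \<Longrightarrow> \<bar>F y $ i $ j\<bar> \<le> B"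
  shows "jump_functional 0 (\<lambda>_. 0) (pos_entry F j) B (down_fun (\<lambda>y k. F y $ k $ j))"
  by (rule jump_functional_cong[OF jump_functional_down]) (auto simp: pos_entry_def assms)

lemma integrable_down_entry:
  assumes "bounded_Borel F" "0 < v"
  shows "integrable (mark_space lam Q) (down_fun (\<lambda>y k. F y $ k $ j) v v i)"
proof -
  obtain B where "\<And>v i j. 0 < v \<Longrightarrow> \<bar>F v $ i $ j\<bar> \<le> B" using bounded_Borel_entries[OF assms(1)] by blast
  from integrable_jump_functional[OF jump_functional_down_entry[OF this] _ measurable_pos_entry[OF assms(1)]]
  show ?thesis by (simp add: start_ok_diag assms)
qed

lemma V_op_entry:
  assumes "bounded_Borel F" "0 < v"
  shows "V_op c lam p Q w a F v $ i $ j = value_fun 0 (\<lambda>_. 0) (pos_entry F j) v v i"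
proof -
  obtain B where "\<And>v i j. 0 < v \<Longrightarrow> \<bar>F v $ i $ j\<bar> \<le> B" using bounded_Borel_entries[OF assms(1)] by blast
  from integral_jump_functional[OF jump_functional_down_entry[OF this] _ measurable_pos_entry[OF assms(1)]]
  show ?thesis by (simp add: V_op_entry_integral start_ok_diag assms)
qed

lemma bounded_Borel_H: "bounded_Borel H"
proof (rule bounded_BorelI)
  fix i j
  show "(\<lambda>v. value_fun 1 (unit_reward j) (\<lambda>_ _. 0) v v i) \<in> borel_measurable borel"
    by (rule measurable_value_fun) auto
  fix v :: real assume v: "0 < v"
  show "H v $ i $ j = value_fun 1 (unit_reward j) (\<lambda>_ _. 0) v v i" by (rule H_entry[OF v])
  show "\<bar>H v $ i $ j\<bar> \<le> 1" unfolding H_entry[OF v]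
    by (rule abs_value_fun_le[OF jump_functional_drawup[OF unit_reward_bound] _ _ start_ok_diag[OF v]]) auto
qed

lemma bounded_Borel_T_op:
  assumes F: "bounded_Borel F" shows "bounded_Borel (T_op c lam p Q w a F)"
proof -
  obtain B where B: "\<And>v i j. 0 < v \<Longrightarrow> \<bar>F v $ i $ j\<bar> \<le> B" using bounded_Borel_entries[OF F] by blast
  show ?thesis
  proof (rule bounded_BorelI)
    fix i j
    show "(\<lambda>v. value_fun 0 (unit_reward j) (\<lambda>_ _. 0) v v i
        + value_fun 0 (\<lambda>_. 0) (pos_entry F j) v v i) \<in> borel_measurable borel"
      by (intro borel_measurable_add measurable_value_fun) (auto intro: measurable_pos_entry[OF F])
    fix v :: real assume v: "0 < v"
    show eq: "T_op c lam p Q w a F v $ i $ j = value_fun 0 (unit_reward j) (\<lambda>_ _. 0) v v i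
        + value_fun 0 (\<lambda>_. 0) (pos_entry F j) v v i"
      by (simp add: T_op_def Z_plus_entry[OF v] V_op_entry[OF F v])
    have "\<bar>value_fun 0 (unit_reward j) (\<lambda>_ _. 0) v v i\<bar> \<le> 1"
      by (rule abs_value_fun_le[OF jump_functional_up[OF unit_reward_bound] _ _ start_ok_diag[OF v]]) auto
    moreover have "\<bar>value_fun 0 (\<lambda>_. 0) (pos_entry F j) v v i\<bar> \<le> B"
      by (rule abs_value_fun_le[OF jump_functional_down_entry[OF B] _ _ start_ok_diag[OF v]])
         (auto intro: measurable_pos_entry[OF F])
    ultimately show "\<bar>T_op c lam p Q w a F v $ i $ j\<bar> \<le> 1 + B" unfolding eq by linarith
  qed
qed

text \<open>
  By restarting at the first passage below \<open>v\<close>, \<open>H\<close> and \<open>T_op H\<close> extend to starting levels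
  \<open>x\<close> above the running minimum \<open>v\<close>, where both solve the same one-jump equation; that equation
  is a contraction, so no strong Markov property at the passage time is needed.
\<close>

lemma H_fixed_point:
  assumes v: "0 < v" shows "H v = T_op c lam p Q w a H v"
proof -
  have "H v $ i $ j = T_op c lam p Q w a H v $ i $ j" for i j
  proof -
    let ?R = "unit_reward j" and ?G = "pos_entry H j"
    let ?h = "value_fun 1 ?R (\<lambda>_ _. 0)" and ?h' = "value_fun 0 ?R ?G"
    obtain B where B: "\<And>v i j. 0 < v \<Longrightarrow> \<bar>H v $ i $ j\<bar> \<le> B"
      using bounded_Borel_entries[OF bounded_Borel_H] by blast
    have B0: "0 \<le> B" using B[of 1 i j] by simp
    note G = measurable_pos_entry[OF bounded_Borel_H]
    have \<Phi>: "jump_functional 1 ?R (\<lambda>_ _. 0) 1 (drawup_fun ?R)"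
      by (rule jump_functional_drawup[OF unit_reward_bound])
    \<comment> \<open>The extension of \<open>T_op H\<close> off the diagonal: the path is killed at
      the passage and is paid the entry of \<open>H\<close> at the landing level.\<close>
    have \<Phi>': "jump_functional 0 ?R ?G (1 + B)
        (\<lambda>x v i \<omega>. up_fun ?R x v i \<omega> + down_fun (\<lambda>y k. H y $ k $ j) x v i \<omega>)"
      using jump_functional_add[OF jump_functional_up[OF unit_reward_bound] jump_functional_down_entry[OF B]]
      by simp
    have h_le: "\<bar>?h y u k\<bar> \<le> 1 + B" "\<bar>?h' y u k\<bar> \<le> 1 + B" if "start_ok y u" for y u k
      using abs_value_fun_le[OF \<Phi> _ _ that, of k] abs_value_fun_le[OF \<Phi>' _ G that, of k] B0 by simp_all
    have G_le: "\<bar>?G y k\<bar> \<le> 1 + B" if "0 < y" for y k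
      using B[OF that, of k j] that by (simp add: pos_entry_def)
    have R_le: "\<bar>?R k\<bar> \<le> 1 + B" for k using unit_reward_bound[of j k] B0 by linarith
    \<comment> \<open>The restarted value at a landing level \<open>y\<close> is
      \<open>?h y y\<close>, an entry of \<open>H y\<close>. The restart with \<theta> equal to
      \<open>1\<close> can thus be read as the terminal reward \<open>?G\<close> with \<theta> equal
      to \<open>0\<close>.\<close>
    have h_step: "?h x u k = (\<integral>m. jump_step 0 ?R ?G x u k m ?h \<partial>mark_law lam Q k)"
      if ok: "start_ok x u" for x u k
    proof -
      have "?h x u k = (\<integral>m. jump_step 1 ?R (\<lambda>_ _. 0) x u k m ?h \<partial>mark_law lam Q k)"
        by (rule value_fun_step[OF \<Phi> _ _ ok]) auto
      also have "\<dots> = (\<integral>m. jump_step 0 ?R ?G x u k m ?h \<partial>mark_law lam Q k)"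
      proof (rule integral_cong_AE)
        show "AE m in mark_law lam Q k. jump_step 1 ?R (\<lambda>_ _. 0) x u k m ?h = jump_step 0 ?R ?G x u k m ?h"
          using AE_mark_law_pos
        proof eventually_elim
          case (elim m)
          from after_jump_pos[OF ok elim, of k] show ?case
            by (simp add: jump_step_def pos_entry_def H_entry)
        qed
      qed (auto intro!: measurable_jump_step G measurable_value_fun measurable_ident_sets[OF sets_mark_law])
      finally show ?thesis .
    qed
    \<comment> \<open>Both values are bounded by \<open>1 + B\<close>, which gives the initial
      constant; each use of the common equation gains a factor \<open>beta\<close>.\<close>
    have diff: "\<bar>?h x u k - ?h' x u k\<bar> \<le> (2 + 2 * B) * beta c lam w a ^ n" if "start_ok x u" for x u k n
      using that
    proof (induction n arbitrary: x u k)
      case 0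
      with h_le[OF 0, of k] show ?case by simp
    next
      case (Suc n)
      have "\<bar>?h x u k - ?h' x u k\<bar> = \<bar>(\<integral>m. jump_step 0 ?R ?G x u k m ?h \<partial>mark_law lam Q k)
          - (\<integral>m. jump_step 0 ?R ?G x u k m ?h' \<partial>mark_law lam Q k)\<bar>"
        using h_step[OF Suc.prems] value_fun_step[OF \<Phi>' _ G Suc.prems] by simp
      also have "\<dots> \<le> beta c lam w a * ((2 + 2 * B) * beta c lam w a ^ n)"
        using Suc.prems B0 beta_nonneg
        by (intro integral_jump_step_diff integrable_jump_step[where B="1 + B"])
           (auto intro: Suc.IH R_le G_le h_le G measurable_value_fun)
      finally show ?case by (simp add: mult_ac)
    qed
    have "\<bar>?h v v i - ?h' v v i\<bar> \<le> 0"
      by (rule nonpos_if_le_geometric[OF diff[OF start_ok_diag[OF v]] beta_nonneg beta_less_1])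
    then have "H v $ i $ j = ?h' v v i" using H_entry[OF v] by simp
    also have "\<dots> = (\<integral>\<omega>. up_fun ?R v v i \<omega> + down_fun (\<lambda>y k. H y $ k $ j) v v i \<omega> \<partial>mark_space lam Q)"
      by (rule integral_jump_functional[OF \<Phi>' _ G start_ok_diag[OF v], symmetric]) simp
    also have "\<dots> = T_op c lam p Q w a H v $ i $ j"
      unfolding T_op_def vector_add_component Z_plus_entry_integral V_op_entry_integral
      by (intro Bochner_Integration.integral_add integrable_down_entry[OF bounded_Borel_H v]
          integrable_jump_functional[OF jump_functional_up[OF unit_reward_bound]] start_ok_diag[OF v]) auto
    finally show ?thesis .
  qed
  then show ?thesis by (simp add: vec_eq_iff)
qed

lemma V_op_diff:
  assumes F: "bounded_Borel F" and F': "bounded_Borel F'" and v: "0 < v"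
  shows "V_op c lam p Q w a (\<lambda>v. F v - F' v) v = V_op c lam p Q w a F v - V_op c lam p Q w a F' v"
proof -
  have "down_fun (\<lambda>y k. (F y - F' y) $ k $ j) v v i \<omega>
      = down_fun (\<lambda>y k. F y $ k $ j) v v i \<omega> - down_fun (\<lambda>y k. F' y $ k $ j) v v i \<omega>" for i j \<omega>
    by (simp add: down_fun_def Let_def right_diff_distrib)
  then show ?thesis
    by (simp add: vec_eq_iff V_op_entry_integral
        Bochner_Integration.integral_diff[OF integrable_down_entry[OF F v] integrable_down_entry[OF F' v]])
qed

text \<open>Without a restart the two branches after the jump exclude each other, so the bounds on
  \<open>G\<close> and \<open>h\<close> do not add and the constant remains
  \<open>C\<close>.\<close>

lemma abs_jump_step_killed:
  assumes "start_ok x v" "0 < fst m" "0 \<le> C"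
    and G: "\<And>y k. 0 < y \<Longrightarrow> \<bar>G y k\<bar> \<le> C" and h: "\<And>y u k. start_ok y u \<Longrightarrow> \<bar>h y u k\<bar> \<le> C"
  shows "\<bar>jump_step 0 (\<lambda>_. 0) G x v i m h\<bar>
    \<le> (if c i * (v + a - x) < fst m then 0 else exp (- w * fst m)) * C"
  using start_ok_stepE[OF assms(1,2), of i] G[OF after_jump_pos[OF assms(1,2)], of i "snd m"] h assms(3)
  by (auto simp: jump_step_def abs_mult)

text \<open>
  The first passage below \<open>v\<close> happens at a jump, so before level \<open>v + a\<close> is reached it cannot precede
  the first jump, which must occur before time \<open>c i * a\<close>.  The signs turn a row of absolute values
  into a single killed functional.
\<close>

lemma mat_norm_V_op:
  assumes F: "bounded_Borel F" and C: "\<And>y. 0 < y \<Longrightarrow> mat_norm (F y) \<le> C" and v: "0 < v"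
  shows "mat_norm (V_op c lam p Q w a F v) \<le> beta c lam w a * C"
  unfolding mat_norm_le_iff
proof
  fix i
  have C0: "0 \<le> C" using C[of 1] mat_norm_nonneg[of "F 1"] by linarith
  let ?V = "V_op c lam p Q w a F v"
  define \<epsilon> where "\<epsilon> j = sgn (?V $ i $ j)" for j
  let ?g = "\<lambda>y k. \<Sum>j\<in>UNIV. \<epsilon> j * F y $ k $ j"
  let ?G = "\<lambda>y k. \<Sum>j\<in>UNIV. \<epsilon> j * pos_entry F j y k"
  have G_le: "\<bar>?g y k\<bar> \<le> C" if "0 < y" for y k
  proof -
    have "\<bar>?g y k\<bar> \<le> (\<Sum>j\<in>UNIV. \<bar>\<epsilon> j * F y $ k $ j\<bar>)" by (rule sum_abs)
    also have "\<dots> \<le> (\<Sum>j\<in>UNIV. \<bar>F y $ k $ j\<bar>)"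
      by (intro sum_mono) (simp add: \<epsilon>_def abs_mult sgn_if)
    also have "\<dots> \<le> C" using row_sum_le_mat_norm C[OF that] by (rule order_trans)
    finally show ?thesis .
  qed
  have eq: "?g y k = ?G y k" if "0 < y" for y k using that by (simp add: pos_entry_def)
  have \<Phi>: "jump_functional 0 (\<lambda>_. 0) ?G C (down_fun ?g)"
    by (rule jump_functional_cong[OF jump_functional_down[OF G_le] eq])
  have G: "(\<lambda>y. ?G y k) \<in> borel_measurable borel" for k
    by (intro borel_measurable_sum borel_measurable_times measurable_pos_entry[OF F] measurable_const) simp
  let ?h = "value_fun 0 (\<lambda>_. 0) ?G"
  have "(\<Sum>j\<in>UNIV. \<bar>?V $ i $ j\<bar>) = (\<Sum>j\<in>UNIV. \<epsilon> j * ?V $ i $ j)"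
    by (simp add: \<epsilon>_def abs_sgn mult.commute)
  also have "\<dots> = (\<Sum>j\<in>UNIV. \<integral>\<omega>. \<epsilon> j * down_fun (\<lambda>y k. F y $ k $ j) v v i \<omega> \<partial>mark_space lam Q)"
    by (simp add: V_op_entry_integral)
  also have "\<dots> = (\<integral>\<omega>. (\<Sum>j\<in>UNIV. \<epsilon> j * down_fun (\<lambda>y k. F y $ k $ j) v v i \<omega>) \<partial>mark_space lam Q)"
    by (intro Bochner_Integration.integral_sum[symmetric] integrable_mult_right integrable_down_entry F v)
  also have "\<dots> = (\<integral>\<omega>. down_fun ?g v v i \<omega> \<partial>mark_space lam Q)"
    by (intro Bochner_Integration.integral_cong) (auto simp: down_fun_def Let_def sum_distrib_left mult_ac)
  also have "\<dots> = ?h v v i"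
    by (rule integral_jump_functional[OF \<Phi> _ G start_ok_diag[OF v]]) simp
  also have "\<dots> = (\<integral>m. jump_step 0 (\<lambda>_. 0) ?G v v i m ?h \<partial>mark_law lam Q i)"
    by (rule value_fun_step[OF \<Phi> _ G start_ok_diag[OF v]]) simp
  also have "\<dots> \<le> \<bar>\<integral>m. jump_step 0 (\<lambda>_. 0) ?G v v i m ?h \<partial>mark_law lam Q i\<bar>" by (rule abs_ge_self)
  also have "\<dots> \<le> beta c lam w a * C"
  proof (rule integral_first_jump_bound[OF start_ok_diag[OF v] C0])
    have h_le: "\<bar>?h y u k\<bar> \<le> C" if "start_ok y u" for y u k
      by (rule abs_value_fun_le[OF \<Phi> _ G that]) simp
    show "integrable (mark_law lam Q i) (\<lambda>m. jump_step 0 (\<lambda>_. 0) ?G v v i m ?h)"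
      by (rule integrable_jump_step[where B=C])
         (use G_le eq C0 in \<open>auto intro: start_ok_diag[OF v] h_le G measurable_value_fun\<close>)
    show "AE m in mark_law lam Q i. \<bar>jump_step 0 (\<lambda>_. 0) ?G v v i m ?h\<bar>
        \<le> (if c i * (v + a - v) < fst m then 0 else exp (- w * fst m)) * C"
      using AE_mark_law_pos
    proof eventually_elim
      case (elim m)
      show ?case
        by (rule abs_jump_step_killed[OF start_ok_diag[OF v] elim C0]) (use G_le eq h_le in auto)
    qed
  qed
  finally show "(\<Sum>j\<in>UNIV. \<bar>?V $ i $ j\<bar>) \<le> beta c lam w a * C" .
qed

text \<open>\<open>Z_plus\<close> is independent of the argument and cancels; by linearity
  \<open>V_op\<close> of the difference is left.\<close>

lemma mat_norm_T_op_diff: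
  assumes "bounded_Borel F" "bounded_Borel F'" "\<And>y. 0 < y \<Longrightarrow> mat_norm (F y - F' y) \<le> C" "0 < v"
  shows "mat_norm (T_op c lam p Q w a F v - T_op c lam p Q w a F' v) \<le> beta c lam w a * C"
  using mat_norm_V_op[OF bounded_Borel_diff[OF assms(1,2)] assms(3,4)]
  by (simp add: T_op_def V_op_diff[OF assms(1,2,4)])

section \<open>Strict bounds on the row sums\<close>

lemma H_nonneg:
  assumes "0 < v" shows "0 \<le> H v $ i $ j"
  unfolding H_entry_integral
  by (rule Bochner_Integration.integral_nonneg) (simp add: drawup_fun_def unit_reward_def Let_def)

text \<open>Everything rests on the event \<open>?A\<close> that the first holding time exceeds
  \<open>c i * a\<close>. It has positive probability, and on it the draw-up is completed exactly at
  time \<open>c i * a\<close>, with a discount strictly between \<open>0\<close> and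
  \<open>1\<close>; off this event the integrand lies in the closed unit interval.\<close>

lemma H_row_sum:
  assumes v: "0 < v"
  shows "0 < (\<Sum>j\<in>UNIV. H v $ i $ j)" "(\<Sum>j\<in>UNIV. H v $ i $ j) < 1"
proof -
  interpret prob_space "mark_law lam Q i" by (rule prob_space_mark_law)
  let ?R = "\<lambda>_::'m. 1::real" and ?h = "value_fun 1 (\<lambda>_. 1) (\<lambda>_ _. 0)"
  have \<Phi>: "jump_functional 1 ?R (\<lambda>_ _. 0) 1 (drawup_fun ?R)"
    by (rule jump_functional_drawup) simp
  have ok: "start_ok v v" by (rule start_ok_diag[OF v])
  have h01: "0 \<le> ?h y u k" "?h y u k \<le> 1" if "start_ok y u" for y u k
  proof -
    show "0 \<le> ?h y u k"
      by (rule value_fun_bounds(1)[OF \<Phi> _ _ that, of _ _ 1])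
         (use \<Phi> that in \<open>auto simp: drawup_fun_def Let_def drawup_time_nonneg real_of_ereal_pos w less_imp_le\<close>)
    show "?h y u k \<le> 1" using abs_value_fun_le[OF \<Phi> _ _ that, of k] by simp
  qed
  have "(\<Sum>j\<in>UNIV. H v $ i $ j) = (\<integral>\<omega>. (\<Sum>j\<in>UNIV. drawup_fun (unit_reward j) v v i \<omega>) \<partial>mark_space lam Q)"
    unfolding H_entry_integral
    by (intro Bochner_Integration.integral_sum[symmetric]
        integrable_jump_functional[OF jump_functional_drawup[OF unit_reward_bound]] ok) auto
  also have "\<dots> = (\<integral>\<omega>. drawup_fun ?R v v i \<omega> \<partial>mark_space lam Q)"
    by (intro Bochner_Integration.integral_cong)
       (auto simp: drawup_fun_def Let_def unit_reward_def simp flip: sum_distrib_left)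
  also have "\<dots> = ?h v v i" by (rule integral_jump_functional[OF \<Phi> _ _ ok]) auto
  also have "\<dots> = (\<integral>m. jump_step 1 ?R (\<lambda>_ _. 0) v v i m ?h \<partial>mark_law lam Q i)" (is "_ = (\<integral>m. ?J m \<partial>_)")
    by (rule value_fun_step[OF \<Phi> _ _ ok]) auto
  finally have eq: "(\<Sum>j\<in>UNIV. H v $ i $ j) = (\<integral>m. ?J m \<partial>mark_law lam Q i)" .
  let ?u = "c i * a"
  let ?A = "{m \<in> space (mark_law lam Q i). ?u < fst m}"
  have u: "0 < ?u" using c[of i] a by simp
  have A [measurable]: "?A \<in> sets (mark_law lam Q i)" by measurable
  have PA: "measure (mark_law lam Q i) ?A = exp (- (lam i * ?u))" by (rule prob_mark_law_gt) (use u in simp)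
  have intJ: "integrable (mark_law lam Q i) ?J"
    using h01 by (intro integrable_jump_step[where B=1] ok) (auto intro!: measurable_value_fun simp: abs_le_iff)
  have J: "AE m in mark_law lam Q i. exp (- w * ?u) * indicator ?A m \<le> ?J m
      \<and> ?J m \<le> 1 - (1 - exp (- w * ?u)) * indicator ?A m"
    using AE_mark_law_pos AE_space
  proof eventually_elim
    case (elim m)
    show ?case
    proof (cases "?u < fst m")
      case True
      with elim show ?thesis by (simp add: jump_step_def)
    next
      case False
      define y where "y = p i * (v + fst m / c i)"
      define r where "r = (if y < v then ?h y y (snd m) else ?h y v (snd m))"
      have "0 \<le> r" "r \<le> 1"
        using start_ok_stepE[OF ok elim(1), of i] False h01 by (simp_all add: r_def y_def)
      moreover have "?J m = exp (- w * fst m) * r" using False by (simp add: jump_step_def r_def y_def)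
      moreover have "exp (- w * fst m) \<le> 1" using elim(1) w by simp
      ultimately have "0 \<le> ?J m" "?J m \<le> 1" by (simp_all add: mult_le_one)
      with False show ?thesis by simp
    qed
  qed
  have intA: "integrable (mark_law lam Q i) (\<lambda>m. r * indicator ?A m)" for r :: real
    by (rule integrable_mark_law_bounded[of _ _ "\<bar>r\<bar>"]) (auto split: split_indicator)
  have "exp (- w * ?u) * exp (- (lam i * ?u)) = (\<integral>m. exp (- w * ?u) * indicator ?A m \<partial>mark_law lam Q i)"
    by (simp flip: PA)
  also have "\<dots> \<le> (\<integral>m. ?J m \<partial>mark_law lam Q i)"
    by (rule integral_mono_AE[OF intA intJ]) (use J in \<open>auto elim!: eventually_mono\<close>)
  finally show "0 < (\<Sum>j\<in>UNIV. H v $ i $ j)"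
    unfolding eq by (rule less_le_trans[rotated]) simp
  have "(\<integral>m. ?J m \<partial>mark_law lam Q i) \<le> (\<integral>m. 1 - (1 - exp (- w * ?u)) * indicator ?A m \<partial>mark_law lam Q i)"
    by (rule integral_mono_AE[OF intJ]) (use J intA in \<open>auto elim!: eventually_mono\<close>)
  also have "\<dots> = 1 - (1 - exp (- w * ?u)) * exp (- (lam i * ?u))"
    using intA by (simp add: prob_space flip: PA)
  also have "\<dots> < 1" using u w by simp
  finally show "(\<Sum>j\<in>UNIV. H v $ i $ j) < 1" unfolding eq .
qed

lemma mat_norm_H: "0 < v \<Longrightarrow> mat_norm (H v) \<le> 1"
  unfolding mat_norm_le_iff using H_row_sum(2) H_nonneg by (auto intro: less_imp_le)

section \<open>Uniqueness and convergence of the iterates\<close>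

lemma H_unique:
  assumes F: "bounded_Borel F" and fixed: "\<And>v. 0 < v \<Longrightarrow> F v = T_op c lam p Q w a F v" and v: "0 < v"
  shows "F v = H v"
proof -
  obtain B where B: "\<And>v i j. 0 < v \<Longrightarrow> \<bar>(F v - H v) $ i $ j\<bar> \<le> B"
    using bounded_Borel_entries[OF bounded_Borel_diff[OF F bounded_Borel_H]] by blast
  \<comment> \<open>Turns the entrywise bound into one for row sums, the start of the
    induction.\<close>
  let ?C = "\<Sum>j\<in>(UNIV::'m set). B"
  have *: "mat_norm (F v - H v) \<le> ?C * beta c lam w a ^ n" if "0 < v" for v n
    using that
  proof (induction n arbitrary: v)
    case 0
    show ?case unfolding mat_norm_le_iff power_0 mult_1_right by (intro allI sum_mono B 0)
  next
    case (Suc n)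
    from mat_norm_T_op_diff[OF F bounded_Borel_H Suc.IH Suc.prems] show ?case
      using fixed[OF Suc.prems] H_fixed_point[OF Suc.prems] by (simp add: mult_ac)
  qed
  have "mat_norm (F v - H v) \<le> 0"
    by (rule nonpos_if_le_geometric[OF *[OF v] beta_nonneg beta_less_1])
  then have "(F v - H v) $ i $ j = 0" for i j
    using entry_le_mat_norm[of "F v - H v" i j] by linarith
  then show ?thesis by (simp add: vec_eq_iff)
qed

lemma mat_norm_iterates:
  assumes 0: "\<And>v. 0 < v \<Longrightarrow> K 0 v = 0"
    and Suc: "\<And>n v. 0 < v \<Longrightarrow> K (Suc n) v = T_op c lam p Q w a (K n) v" and v: "0 < v"
  shows "mat_norm (H v - K n v) \<le> beta c lam w a ^ n"
proof -
  \<comment> \<open>The iterates are prescribed on \<open>{0<..}\<close> only, so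
    \<open>K (Suc n)\<close> equals \<open>T_op\<close> of its predecessor merely there.\<close>
  have cong: "bounded_Borel F'" if F: "bounded_Borel F" and eq: "\<And>v. 0 < v \<Longrightarrow> F' v = F v" for F F' :: "real \<Rightarrow> real ^ 'm ^ 'm"
  proof -
    obtain B where B: "\<And>v i j. 0 < v \<Longrightarrow> \<bar>F v $ i $ j\<bar> \<le> B" using bounded_Borel_entries[OF F] by blast
    show ?thesis
      by (rule bounded_BorelI[where f="\<lambda>i j v. pos_entry F j v i" and B=B])
         (simp_all add: eq B measurable_pos_entry[OF F], simp add: pos_entry_def)
  qed
  have K: "bounded_Borel (K n)" for n
  proof (induction n)
    case 0
    have "bounded_Borel (\<lambda>_. 0 :: real ^ 'm ^ 'm)" by (simp add: bounded_Borel_def image_constant_conv)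
    then show ?case by (rule cong) (rule \<open>\<And>v. 0 < v \<Longrightarrow> K 0 v = 0\<close>)
  next
    case (Suc n)
    from bounded_Borel_T_op[OF this] show ?case by (rule cong) (rule assms(2))
  qed
  show ?thesis using v
  proof (induction n arbitrary: v)
    case 0
    \<comment> \<open>Row sums of \<open>H\<close> below \<open>1\<close> are the reason why no
      constant precedes \<open>beta ^ n\<close>.\<close>
    then show ?case using mat_norm_H by (simp add: assms(1))
  next
    case (Suc n)
    from mat_norm_T_op_diff[OF bounded_Borel_H K Suc.IH Suc.prems] show ?case
      using assms(2)[OF Suc.prems] H_fixed_point[OF Suc.prems] by simp
  qed
qed

end

theorem theorem6p2:
  fixes c lam p :: "'m::finite \<Rightarrow> real" and Q :: "real ^ 'm ^ 'm" and w a :: real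
  assumes "\<And>i. c i > 0" and "\<And>i. lam i > 0" and "\<And>i. 0 < p i \<and> p i < 1"
    and "stochastic_matrix Q" and "w > 0" and "a > 0"
  shows "bounded_Borel (H_mat c lam p Q w a)
    \<and> (\<forall>v>0. H_mat c lam p Q w a v = T_op c lam p Q w a (H_mat c lam p Q w a) v)
    \<and> (\<forall>G. bounded_Borel G \<and> (\<forall>v>0. G v = T_op c lam p Q w a G v)
          \<longrightarrow> (\<forall>v>0. G v = H_mat c lam p Q w a v))
    \<and> (\<forall>v>0. \<forall>i. 0 < (H_mat c lam p Q w a v *v 1) $ i \<and> (H_mat c lam p Q w a v *v 1) $ i < 1)
    \<and> (\<forall>H :: nat \<Rightarrow> real \<Rightarrow> real ^ 'm ^ 'm.
          (\<forall>v>0. H 0 v = 0) \<and> (\<forall>n. \<forall>v>0. H (Suc n) v = T_op c lam p Q w a (H n) v)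
          \<longrightarrow> (\<forall>n. sup_norm (\<lambda>v. H_mat c lam p Q w a v - H n v) \<le> ereal (beta c lam w a ^ n)))"
proof -
  interpret jump_model c lam p Q w a
    using assms by unfold_locales auto
  have row: "(H v *v 1) $ i = (\<Sum>j\<in>UNIV. H v $ i $ j)" for v i
    by (simp add: matrix_vector_mult_def)
  have iter: "sup_norm (\<lambda>v. H v - K n v) \<le> ereal (beta c lam w a ^ n)"
    if "\<forall>v>0. K 0 v = 0" "\<forall>n. \<forall>v>0. K (Suc n) v = T_op c lam p Q w a (K n) v" for K n
    unfolding sup_norm_def using that by (intro SUP_least) (auto intro!: mat_norm_iterates)
  show ?thesis
    using bounded_Borel_H H_fixed_point H_unique H_row_sum iter unfolding row by blast
qed

end
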